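(* For a graph $G$, its triangle graph $\mathcal{T}(G)$ is a tree if and only if $G$ is triangle-connected and does not contain a (not necessarily induced) subgraph which is isomorphic to one of the following graphs: (a) $W_n$, for $n\ge 3$; (b) $K_5-K_3$; (c) $C_n^2$, for $n\ge 5$; (d) $K_6-K_3$; (e) $K_6-P_4$; (f) graphs obtained from any of the graphs described in (c)–(e) by any number of weak edge splittings and weak vertex stickings.
   Context: All graphs are finite, simple and undirected. A triangle is a $K_3$ subgraph. The triangle graph $\mathcal{T}(G)$ of $G$ has one vertex for each triangle of $G$, two vertices being adjacent if and only if the corresponding triangles share an edge. $G$ is triangle-connected if $\mathcal{T}(G)$ is connected. $W_n=K_1\vee C_n$ is the $n$-wheel. $C_m^2$ is the square of the $m$-cycle (vertices adjacent iff at distance $1$ or $2$ in $C_m$). $K_n-F$ is the graph obtained from $K_n$ by deleting the edge set of a subgraph isomorphic to $F$; $P_4$ is the path on 4 vertices. The weak operations are applied to a graph $H$ together with a specified induced cycle of $\mathcal{T}(H)$ which does not consist of three triangles of $H$ sharing a common edge. The triangles of $H$ corresponding to the vertices of this cycle are called cycle-triangles; an edge is private if it belongs to exactly one cycle-triangle. The starting graphs $C_m^2$, $K_6-K_3$, $K_6-P_4$ are taken with a specified induced cycle in their triangle graph of length $m$, $6$, $6$, respectively. Weak edge splitting: for a private edge $e=uv$ belonging to the cycle-triangle $uvx$, delete the edge $uv$, introduce a new vertex $w$ and add the edges $uw,wv,wx$. In the specified cycle, the triangle $uvx$ is replaced by the two consecutive triangles $uwx$, $wvx$, giving the specified cycle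 (one longer) of the new graph. Weak vertex sticking: for two vertices $u,v$ at distance at least $3$ apart, remove $u$ and $v$ and introduce a new vertex $w$ adjacent to all of $N(u)\cup N(v)$, where $N(\cdot)$ is the open neighborhood. The specified cycle is kept, with $u$ and $v$ replaced by $w$ in the cycle-triangles. *)

theory Defs
  imports "Graph_Theory.Graph_Theory"
begin

text \<open>
  A finite simple undirected graph is a symmetric loop-free finite digraph
  (locale \<^locale>\<open>pair_graph\<close>); an edge \<open>uv\<close> is represented by its two arcs.
\<close>

definition contains_copy :: "'a pair_pre_digraph \<Rightarrow> 'b pair_pre_digraph \<Rightarrow> bool" where
  "contains_copy G H \<longleftrightarrow>
     (\<exists>K :: 'a pair_pre_digraph. subgraph (with_proj K) (with_proj G) \<and>
        digraph_iso (with_proj H) (with_proj K))"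

text \<open>Distance as the least number of edges of a walk (\<open>\<infinity>\<close> if there is none).\<close>

definition graph_dist :: "'a pair_pre_digraph \<Rightarrow> 'a \<Rightarrow> 'a \<Rightarrow> ereal" where
  "graph_dist G u v = wf_digraph.\<mu> (with_proj G) (\<lambda>_. 1) u v"


subsection \<open>Standard graphs and constructions\<close>

definition complete_graph :: "'a set \<Rightarrow> 'a pair_pre_digraph" where
  "complete_graph V = \<lparr> pverts = V, parcs = {(u, v). u \<in> V \<and> v \<in> V \<and> u \<noteq> v} \<rparr>"

definition path_graph :: "nat \<Rightarrow> nat pair_pre_digraph" where
  "path_graph n = \<lparr> pverts = {..<n},
     parcs = {(i, j). i < n \<and> j < n \<and> (j = Suc i \<or> i = Suc j)} \<rparr>"

definition cycle_graph :: "nat \<Rightarrow> nat pair_pre_digraph" where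
  "cycle_graph n = \<lparr> pverts = {..<n},
     parcs = {(i, j). i < n \<and> j < n \<and> (j = Suc i mod n \<or> i = Suc j mod n)} \<rparr>"

definition graph_join :: "'a pair_pre_digraph \<Rightarrow> 'a pair_pre_digraph \<Rightarrow> 'a pair_pre_digraph" where
  "graph_join G H = \<lparr> pverts = pverts G \<union> pverts H,
     parcs = parcs G \<union> parcs H \<union> pverts G \<times> pverts H \<union> pverts H \<times> pverts G \<rparr>"

definition delete_edges :: "'a pair_pre_digraph \<Rightarrow> 'a pair_pre_digraph \<Rightarrow> 'a pair_pre_digraph" where
  "delete_edges G F = \<lparr> pverts = pverts G, parcs = parcs G - parcs F \<rparr>"

definition graph_square :: "'a pair_pre_digraph \<Rightarrow> 'a pair_pre_digraph" where
  "graph_square G = \<lparr> pverts = pverts G,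
     parcs = {(u, v). u \<in> pverts G \<and> v \<in> pverts G \<and>
                      (graph_dist G u v = 1 \<or> graph_dist G u v = 2)} \<rparr>"

definition wheel_graph :: "nat \<Rightarrow> nat pair_pre_digraph" where
  "wheel_graph n = graph_join (complete_graph {n}) (cycle_graph n)"

definition K5_minus_K3 :: "nat pair_pre_digraph" where
  "K5_minus_K3 = delete_edges (complete_graph {..<5}) (complete_graph {..<3})"

definition K6_minus_K3 :: "nat pair_pre_digraph" where
  "K6_minus_K3 = delete_edges (complete_graph {..<6}) (complete_graph {..<3})"

definition K6_minus_P4 :: "nat pair_pre_digraph" where
  "K6_minus_P4 = delete_edges (complete_graph {..<6}) (path_graph 4)"

text \<open>
  The library's \<^const>\<open>tree\<close> counts the closed walk \<open>a, b, a\<close> along a single edge as a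
  cycle, so it is unsuitable for symmetric digraphs. As for \<^const>\<open>connected\<close>,
  the graph without vertices is not a tree.
\<close>

definition undirected_tree :: "'a pair_pre_digraph \<Rightarrow> bool" where
  "undirected_tree G \<longleftrightarrow>
     connected (with_proj G) \<and> \<not> (\<exists>n \<ge> 3. contains_copy G (cycle_graph n))"

text \<open>An induced cycle is given by its vertex set, which determines it.\<close>

definition induced_cycle :: "'a pair_pre_digraph \<Rightarrow> 'a set \<Rightarrow> bool" where
  "induced_cycle G S \<longleftrightarrow> S \<subseteq> pverts G \<and> card S \<ge> 3 \<and>
     digraph_iso (with_proj (cycle_graph (card S))) (with_proj G \<restriction> S)"


subsection \<open>Triangle graphs\<close>

text \<open>A triangle is represented by its set of three vertices.\<close>

definition triangles :: "'a pair_pre_digraph \<Rightarrow> 'a set set" where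
  "triangles G = {t. t \<subseteq> pverts G \<and> card t = 3 \<and> (\<forall>u\<in>t. \<forall>v\<in>t. u \<noteq> v \<longrightarrow> (u, v) \<in> parcs G)}"

definition triangle_edges :: "'a set \<Rightarrow> 'a set set" where
  "triangle_edges t = {e. e \<subseteq> t \<and> card e = 2}"

definition triangle_graph :: "'a pair_pre_digraph \<Rightarrow> 'a set pair_pre_digraph" where
  "triangle_graph G = \<lparr> pverts = triangles G,
     parcs = {(s, t). s \<in> triangles G \<and> t \<in> triangles G \<and> s \<noteq> t \<and>
                      triangle_edges s \<inter> triangle_edges t \<noteq> {}} \<rparr>"

definition triangle_connected :: "'a pair_pre_digraph \<Rightarrow> bool" where
  "triangle_connected G \<longleftrightarrow> connected (with_proj (triangle_graph G))"


subsection \<open>Weak operations\<close>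

text \<open>The pairs \<open>(H, S)\<close> to which the weak operations apply; \<open>S\<close> is the set of cycle-triangles.\<close>

definition specified_cycle :: "'a pair_pre_digraph \<Rightarrow> 'a set set \<Rightarrow> bool" where
  "specified_cycle H S \<longleftrightarrow> induced_cycle (triangle_graph H) S \<and>
     \<not> (card S = 3 \<and> (\<exists>e. \<forall>t\<in>S. e \<in> triangle_edges t))"

definition private_edge :: "'a set set \<Rightarrow> 'a set \<Rightarrow> bool" where
  "private_edge S e \<longleftrightarrow> (\<exists>!t. t \<in> S \<and> e \<in> triangle_edges t)"

definition split_edge :: "'a pair_pre_digraph \<Rightarrow> 'a \<Rightarrow> 'a \<Rightarrow> 'a \<Rightarrow> 'a \<Rightarrow> 'a pair_pre_digraph" where
  "split_edge H u v x w = \<lparr> pverts = insert w (pverts H),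
     parcs = (parcs H - {(u, v), (v, u)}) \<union> {(u, w), (w, u), (w, v), (v, w), (w, x), (x, w)} \<rparr>"

definition stick_vertices :: "'a pair_pre_digraph \<Rightarrow> 'a \<Rightarrow> 'a \<Rightarrow> 'a \<Rightarrow> 'a pair_pre_digraph" where
  "stick_vertices H u v w = (let N = parcs H `` {u} \<union> parcs H `` {v} in
     \<lparr> pverts = insert w (pverts H - {u, v}),
       parcs = {(a, b) \<in> parcs H. a \<notin> {u, v} \<and> b \<notin> {u, v}} \<union> {w} \<times> N \<union> N \<times> {w} \<rparr>)"

text \<open>
  Vertices are natural numbers, so that new vertices are always available. In each starting graph
  the induced cycles of the given length are equivalent under automorphisms,
  so any of them may be the specified one.
\<close>

inductive weakly_derived :: "nat pair_pre_digraph \<Rightarrow> nat set set \<Rightarrow> bool" where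
  square: "\<lbrakk>m \<ge> 5; H = graph_square (cycle_graph m);
      induced_cycle (triangle_graph H) S; card S = m\<rbrakk> \<Longrightarrow> weakly_derived H S"
| K6_K3: "\<lbrakk>H = K6_minus_K3; induced_cycle (triangle_graph H) S; card S = 6\<rbrakk>
      \<Longrightarrow> weakly_derived H S"
| K6_P4: "\<lbrakk>H = K6_minus_P4; induced_cycle (triangle_graph H) S; card S = 6\<rbrakk>
      \<Longrightarrow> weakly_derived H S"
| split: "\<lbrakk>weakly_derived H S; specified_cycle H S;
      {u, v, x} \<in> S; u \<noteq> v; x \<notin> {u, v}; private_edge S {u, v}; w \<notin> pverts H\<rbrakk>
      \<Longrightarrow> weakly_derived (split_edge H u v x w) (S - {{u, v, x}} \<union> {{u, w, x}, {w, v, x}})"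
| stick: "\<lbrakk>weakly_derived H S; specified_cycle H S;
      u \<in> pverts H; v \<in> pverts H; graph_dist H u v \<ge> 3; w \<notin> pverts H\<rbrakk>
      \<Longrightarrow> weakly_derived (stick_vertices H u v w)
            ((\<lambda>t. (\<lambda>z. if z = u \<or> z = v then w else z) ` t) ` S)"

end

theory Submission
  imports Defs
begin

text \<open>
  Both sides of the equivalence contain the connectedness of the triangle graph, so the claim is that
  the triangle graph has a cycle iff one of the listed graphs occurs in \<open>G\<close>.

  If one of them occurs, its triangles contribute a cycle. For the graphs with fixed shape the cycle
  is written down, for \<open>K\<^sub>6 - K\<^sub>3\<close> and \<open>K\<^sub>6 - P\<^sub>4\<close> inside a \<open>K\<^sub>4\<close>. For the derived graphs, a specified cycle is followed through one weak operation
  (\<open>triangle_cyclic_split_edge\<close>, \<open>triangle_cyclic_stick_vertices\<close>): splitting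
  replaces one triangle of the cycle by two, and sticking identifies vertices that are too far apart
  to make triangles collapse or coincide.

  Conversely, a shortest cycle in the triangle graph is induced. Three mutually adjacent triangles
  form a \<open>K\<^sub>4\<close> or a \<open>K\<^sub>5 - K\<^sub>3\<close>. A longer induced cycle is a closed strip in which every
  triangle is glued to the next one along an edge and no edge lies in three triangles. If all its
  triangles share a vertex, it is a wheel. Otherwise the operations are undone. A vertex that occurs
  in several separate runs of consecutive triangles is pulled apart, which reverses a sticking
  (\<open>separate_runs\<close>). Two consecutive triangles \<open>uwx\<close>, \<open>wvx\<close> inside a longer run around \<open>x\<close> are
  merged into \<open>uvx\<close>, which reverses a splitting, unless \<open>uv\<close> is an edge of the strip already
  (\<open>contract_fan\<close>).

  What remains is a strip in which each vertex has one run and every merger is blocked. If no vertex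
  lies in four consecutive triangles, the strip is a zigzag, that is, a \<open>C\<^sub>m\<^sup>2\<close>
  (\<open>strip_without_fan\<close>). Otherwise a blocking edge \<open>uv\<close> forces the runs of \<open>u\<close> and \<open>v\<close> to meet on
  the far side of the strip, while no run has more than four triangles (\<open>no_five_run\<close>). So the strip
  is short, and it is \<open>K\<^sub>6 - K\<^sub>3\<close> or \<open>K\<^sub>6 - P\<^sub>4\<close> (\<open>irreducible_strip_with_fan\<close>). Reading the reduction
  backwards derives the original strip (\<open>strip_derivable\<close>).
\<close>

section \<open>Copies, cycles and distances\<close>

lemma wf_digraph_with_proj_iff:
  "wf_digraph (with_proj G) \<longleftrightarrow> parcs G \<subseteq> pverts G \<times> pverts G"
  by (auto simp: wf_digraph_def)

text \<open>
  Arcs are determined by their ends, so a copy amounts to a vertex map. This avoids the explicit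
  subgraph and arc map of the definition.
\<close>

lemma contains_copyI:
  assumes G: "parcs G \<subseteq> pverts G \<times> pverts G" and H: "parcs H \<subseteq> pverts H \<times> pverts H"
    and f: "inj_on f (pverts H)" "f ` pverts H \<subseteq> pverts G"
    and arcs: "\<And>a b. (a, b) \<in> parcs H \<Longrightarrow> (f a, f b) \<in> parcs G"
  shows "contains_copy G H"
proof -
  let ?K = "\<lparr>pverts = f ` pverts H, parcs = map_prod f f ` parcs H\<rparr>"
  let ?h = "\<lparr>iso_verts = f, iso_arcs = map_prod f f, iso_head = snd, iso_tail = fst\<rparr>"
  have "subgraph (with_proj ?K) (with_proj G)"
    using assms by (auto simp: subgraph_def wf_digraph_with_proj_iff compatible_def)
  moreover have "inj_on (map_prod f f) (parcs H)"
    using H by (intro inj_on_subset[OF map_prod_inj_on[OF f(1) f(1)]])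
  then have "pre_digraph.digraph_isomorphism (with_proj H) ?h"
    using H f(1) by (simp add: pre_digraph.digraph_isomorphism_def wf_digraph_with_proj_iff)
  moreover have "with_proj ?K = app_iso ?h (with_proj H)"
    by (simp add: app_iso_def with_proj_def)
  ultimately show ?thesis
    unfolding contains_copy_def digraph_iso_def by blast
qed

lemma contains_copyE:
  assumes "contains_copy G H"
  obtains f where "inj_on f (pverts H)" "f ` pverts H \<subseteq> pverts G"
    and "\<And>a b. (a, b) \<in> parcs H \<Longrightarrow> (f a, f b) \<in> parcs G"
    and "parcs H \<subseteq> pverts H \<times> pverts H" "parcs G \<subseteq> pverts G \<times> pverts G"
proof -
  from assms obtain K h where K: "subgraph (with_proj K) (with_proj G)"
    and h: "pre_digraph.digraph_isomorphism (with_proj H) h"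
    and eq: "with_proj K = app_iso h (with_proj H)"
    unfolding contains_copy_def digraph_iso_def by blast
  have tl: "iso_tail h = fst" "iso_head h = snd"
    and vs: "pverts K = iso_verts h ` pverts H" and as: "parcs K = iso_arcs h ` parcs H"
    using eq by (simp_all add: app_iso_def with_proj_def)
  have "(iso_verts h a, iso_verts h b) \<in> parcs G" if "(a, b) \<in> parcs H" for a b
  proof -
    have "iso_arcs h (a, b) = (iso_verts h a, iso_verts h b)"
      using h that tl
      by (auto simp: pre_digraph.digraph_isomorphism_def intro!: prod_eqI dest!: bspec)
    moreover have "iso_arcs h (a, b) \<in> parcs G"
      using K that as by (auto simp: subgraph_def)
    ultimately show ?thesis by simp
  qed
  then show ?thesis
    using that[of "iso_verts h"] h K vs
    by (simp add: pre_digraph.digraph_isomorphism_def subgraph_def wf_digraph_with_proj_iff)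
qed

text \<open>
  A cycle, possibly with chords, as an enumeration of its vertices. In this form cycles can be
  rotated, cut and spliced.
\<close>

definition polygon :: "('b \<Rightarrow> 'b \<Rightarrow> bool) \<Rightarrow> nat \<Rightarrow> (nat \<Rightarrow> 'b) \<Rightarrow> bool" where
  "polygon R n c \<longleftrightarrow> 3 \<le> n \<and> inj_on c {..<n} \<and> (\<forall>i<n. R (c i) (c (Suc i mod n)))"

lemma polygonI:
  assumes "3 \<le> n" "inj_on c {..<n}" "\<And>i. Suc i < n \<Longrightarrow> R (c i) (c (Suc i))" "R (c (n - 1)) (c 0)"
  shows "polygon R n c"
proof -
  have "R (c i) (c (Suc i mod n))" if "i < n" for i
  proof (cases "Suc i < n")
    case True
    then show ?thesis using assms by simp
  next
    case False
    then have "i = n - 1" "Suc i = n" using that by auto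
    then show ?thesis using assms by simp
  qed
  then show ?thesis using assms by (simp add: polygon_def)
qed

lemma polygonD:
  assumes "polygon R n c"
  shows "3 \<le> n" "inj_on c {..<n}" "Suc i < n \<Longrightarrow> R (c i) (c (Suc i))" "R (c (n - 1)) (c 0)"
proof -
  show "3 \<le> n" "inj_on c {..<n}" using assms by (auto simp: polygon_def)
  then show "R (c (n - 1)) (c 0)" using assms
    by (auto simp: polygon_def dest!: spec[of _ "n - 1"])
  show "Suc i < n \<Longrightarrow> R (c i) (c (Suc i))" using assms
    by (auto simp: polygon_def dest!: spec[of _ i])
qed

lemma bij_betw_add_mod: "bij_betw (\<lambda>i. (i + k) mod n) {..<n} {..<n :: nat}"
proof (cases "n = 0")
  case False
  have "i = j" if "(i + k) mod n = (j + k) mod n" "i < n" "j < n" for i j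
    using that
  proof (induction i j rule: linorder_wlog)
    case (le i j)
    then have "n dvd j - i" using mod_eq_dvd_iff_nat[of "i + k" "j + k" n] by simp
    moreover have "j - i < n" using le by simp
    ultimately show ?case using le(1) by (auto dest: dvd_imp_le)
  qed auto
  then have "inj_on (\<lambda>i. (i + k) mod n) {..<n}" by (auto intro!: inj_onI)
  moreover have "(\<lambda>i. (i + k) mod n) ` {..<n} \<subseteq> {..<n}" using False by auto
  ultimately show ?thesis
    by (simp add: bij_betw_def card_image card_subset_eq)
qed (simp add: bij_betw_def)

lemma polygon_rotate:
  assumes "polygon R n c"
  shows "polygon R n (\<lambda>i. c ((i + k) mod n))"
    and "(\<lambda>i. c ((i + k) mod n)) ` {..<n} = c ` {..<n}"
proof -
  note b = bij_betw_add_mod[of k n]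
  have "inj_on (\<lambda>i. c ((i + k) mod n)) {..<n}"
    using comp_inj_on[of "\<lambda>i. (i + k) mod n" "{..<n}" c] b assms
    by (simp add: bij_betw_def polygon_def comp_def)
  moreover have "R (c ((i + k) mod n)) (c ((Suc i mod n + k) mod n))" if "i < n" for i
  proof -
    have "(Suc i mod n + k) mod n = Suc ((i + k) mod n) mod n"
      by (simp add: mod_add_left_eq mod_Suc_eq)
    moreover have "(i + k) mod n < n" using that by simp
    ultimately show ?thesis using assms unfolding polygon_def by metis
  qed
  ultimately show "polygon R n (\<lambda>i. c ((i + k) mod n))"
    using assms by (simp add: polygon_def)
  show "(\<lambda>i. c ((i + k) mod n)) ` {..<n} = c ` {..<n}"
    using b image_image[of c "\<lambda>i. (i + k) mod n" "{..<n}"] by (simp add: bij_betw_def)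
qed

lemma parcs_cycle_graph:
  "(i, j) \<in> parcs (cycle_graph n) \<longleftrightarrow> i < n \<and> j < n \<and> (j = Suc i mod n \<or> i = Suc j mod n)"
  and pverts_cycle_graph: "pverts (cycle_graph n) = {..<n}"
  by (auto simp: cycle_graph_def)

lemma contains_cycle_graph_iff:
  assumes "parcs T \<subseteq> pverts T \<times> pverts T" "sym (parcs T)"
  shows "3 \<le> n \<and> contains_copy T (cycle_graph n) \<longleftrightarrow> (\<exists>c. polygon (\<lambda>a b. (a, b) \<in> parcs T) n c)"
    (is "?L \<longleftrightarrow> ?R")
proof
  assume ?L
  then obtain f where "inj_on f {..<n}"
    and "\<And>a b. (a, b) \<in> parcs (cycle_graph n) \<Longrightarrow> (f a, f b) \<in> parcs T"
    by (auto elim: contains_copyE simp: pverts_cycle_graph)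
  then have "polygon (\<lambda>a b. (a, b) \<in> parcs T) n f"
    using \<open>?L\<close> by (auto simp: polygon_def parcs_cycle_graph)
  then show ?R by blast
next
  assume ?R
  then obtain c where c: "polygon (\<lambda>a b. (a, b) \<in> parcs T) n c" ..
  have "contains_copy T (cycle_graph n)"
  proof (rule contains_copyI[of _ _ c])
    show "(c a, c b) \<in> parcs T" if "(a, b) \<in> parcs (cycle_graph n)" for a b
      using c that \<open>sym (parcs T)\<close> by (auto simp: polygon_def parcs_cycle_graph dest: symD)
    show "c ` pverts (cycle_graph n) \<subseteq> pverts T"
      using c assms(1) by (auto simp: polygon_def pverts_cycle_graph)
  qed (use c assms in \<open>auto simp: polygon_def pverts_cycle_graph parcs_cycle_graph\<close>)
  then show ?L using c by (simp add: polygon_def)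
qed

lemma induced_cycleE:
  assumes "induced_cycle T S"
  obtains c where "polygon (\<lambda>a b. (a, b) \<in> parcs T) (card S) c" "c ` {..<card S} = S"
proof -
  from assms obtain h where
    h: "pre_digraph.digraph_isomorphism (with_proj (cycle_graph (card S))) h"
    and eq: "with_proj T \<restriction> S = app_iso h (with_proj (cycle_graph (card S)))"
    and S: "card S \<ge> 3"
    unfolding induced_cycle_def digraph_iso_def by blast
  let ?c = "iso_verts h"
  have tl: "iso_tail h = fst" "iso_head h = snd"
    and vs: "S = ?c ` {..<card S}"
    and as: "{e \<in> parcs T. fst e \<in> S \<and> snd e \<in> S} = iso_arcs h ` parcs (cycle_graph (card S))"
    using eq by (auto simp: app_iso_def induce_subgraph_def pverts_cycle_graph)
  have "(?c i, ?c (Suc i mod card S)) \<in> parcs T" if "i < card S" for i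
  proof -
    let ?e = "(i, Suc i mod card S)"
    have e: "?e \<in> parcs (cycle_graph (card S))"
      using that S by (auto simp: parcs_cycle_graph)
    then have "iso_arcs h ?e = (?c i, ?c (Suc i mod card S))"
      using h tl by (auto simp: pre_digraph.digraph_isomorphism_def intro!: prod_eqI dest!: bspec)
    moreover have "iso_arcs h ?e \<in> parcs T" using as e by auto
    ultimately show ?thesis by simp
  qed
  moreover have "inj_on ?c {..<card S}"
    using h by (simp add: pre_digraph.digraph_isomorphism_def pverts_cycle_graph)
  ultimately show ?thesis
    using that[of ?c] S vs by (simp add: polygon_def)
qed

lemma induced_cycleI:
  assumes c: "inj_on c {..<n}" "c ` {..<n} = S" and n: "3 \<le> n" and S: "S \<subseteq> pverts T"
    and arcs: "\<And>i j. i < n \<Longrightarrow> j < n \<Longrightarrow>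
      (c i, c j) \<in> parcs T \<longleftrightarrow> j = Suc i mod n \<or> i = Suc j mod n"
  shows "induced_cycle T S"
proof -
  have card: "card S = n" using c by (metis card_image card_lessThan)
  let ?h = "\<lparr>iso_verts = c, iso_arcs = map_prod c c, iso_head = snd, iso_tail = fst\<rparr>"
  have "inj_on (map_prod c c) (parcs (cycle_graph n))"
    using c(1) by (auto simp: inj_on_def parcs_cycle_graph)
  then have "pre_digraph.digraph_isomorphism (with_proj (cycle_graph n)) ?h"
    using c(1)
    by (auto simp: pre_digraph.digraph_isomorphism_def wf_digraph_with_proj_iff pverts_cycle_graph
        parcs_cycle_graph)
  moreover have "{e \<in> parcs T. fst e \<in> S \<and> snd e \<in> S} = map_prod c c ` parcs (cycle_graph n)"
  proof
    show "{e \<in> parcs T. fst e \<in> S \<and> snd e \<in> S} \<subseteq> map_prod c c ` parcs (cycle_graph n)"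
    proof
      fix e assume "e \<in> {e \<in> parcs T. fst e \<in> S \<and> snd e \<in> S}"
      then obtain i j where "e = (c i, c j)" "i < n" "j < n" "(c i, c j) \<in> parcs T"
        using c(2) by (cases e) auto
      then show "e \<in> map_prod c c ` parcs (cycle_graph n)"
        using arcs by (intro image_eqI[of _ _ "(i, j)"]) (auto simp: parcs_cycle_graph)
    qed
    show "map_prod c c ` parcs (cycle_graph n) \<subseteq> {e \<in> parcs T. fst e \<in> S \<and> snd e \<in> S}"
      using c(2) arcs by (fastforce simp: parcs_cycle_graph)
  qed
  then have "with_proj T \<restriction> S = app_iso ?h (with_proj (cycle_graph n))"
    using c(2) by (simp add: app_iso_def induce_subgraph_def pverts_cycle_graph)
  ultimately show ?thesis
    unfolding induced_cycle_def digraph_iso_def card using n S by blast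
qed

text \<open>Distances are infima of walk lengths, so small ones can be read off short walks.\<close>

context
  fixes G :: "'a pair_pre_digraph"
  assumes wf: "parcs G \<subseteq> pverts G \<times> pverts G"
begin

interpretation wf_digraph "with_proj G" using wf by (simp add: wf_digraph_with_proj_iff)

lemma awalk_cost_length: "awalk_cost (\<lambda>_. 1 :: real) p = real (length p)"
  by (induction p) auto

lemma graph_dist_le_walk: "awalk u p v \<Longrightarrow> graph_dist G u v \<le> ereal (real (length p))"
  unfolding graph_dist_def using min_cost_le_walk_cost[of u p v "\<lambda>_. 1"]
  by (simp add: awalk_cost_length)

lemma graph_dist_ge_iff:
  "ereal r \<le> graph_dist G u v \<longleftrightarrow> (\<forall>p. awalk u p v \<longrightarrow> r \<le> real (length p))"
  unfolding graph_dist_def \<mu>_def by (auto simp: le_INF_iff awalk_cost_length)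

lemma graph_dist_eq_walk_length:
  assumes "graph_dist G u v \<noteq> \<infinity>"
  obtains p where "awalk u p v" "graph_dist G u v = ereal (real (length p))"
proof -
  let ?n = "LEAST n. \<exists>p. awalk u p v \<and> length p = n"
  have "\<exists>p. awalk u p v"
  proof (rule ccontr)
    assume "\<nexists>p. awalk u p v"
    then have "graph_dist G u v = \<infinity>"
      unfolding graph_dist_def by (simp add: \<mu>_def top_ereal_def)
    with assms show False by simp
  qed
  then have "\<exists>n. \<exists>p. awalk u p v \<and> length p = n" by blast
  then have "\<exists>p. awalk u p v \<and> length p = ?n" by (rule LeastI_ex)
  then obtain p where p: "awalk u p v" "length p = ?n" by blast
  moreover have "ereal (real ?n) \<le> graph_dist G u v"
    unfolding graph_dist_ge_iff by (auto intro: Least_le)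
  ultimately show ?thesis
    using graph_dist_le_walk[OF p(1)] that by (metis order_antisym)
qed

lemma awalk_1: "(u, v) \<in> parcs G \<Longrightarrow> awalk u [(u, v)] v"
  using wf by (auto simp: awalk_Cons_iff awalk_Nil_iff)

lemma awalk_2: "(u, c) \<in> parcs G \<Longrightarrow> (c, v) \<in> parcs G \<Longrightarrow> awalk u [(u, c), (c, v)] v"
  using wf by (auto simp: awalk_Cons_iff awalk_Nil_iff)

lemma awalk_0_iff: "awalk u p v \<Longrightarrow> length p = 0 \<Longrightarrow> u = v"
  by (auto simp: awalk_Nil_iff)

lemma awalk_1D: "awalk u p v \<Longrightarrow> length p = 1 \<Longrightarrow> (u, v) \<in> parcs G"
  by (auto simp: length_Suc_conv awalk_Cons_iff awalk_Nil_iff)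

lemma awalk_2D: "awalk u p v \<Longrightarrow> length p = 2 \<Longrightarrow> \<exists>c. (u, c) \<in> parcs G \<and> (c, v) \<in> parcs G"
  by (force simp: length_Suc_conv numeral_2_eq_2 awalk_Cons_iff awalk_Nil_iff)

lemma graph_dist_1_or_2_iff:
  assumes "u \<noteq> v"
  shows "graph_dist G u v = 1 \<or> graph_dist G u v = 2 \<longleftrightarrow>
    (u, v) \<in> parcs G \<or> (\<exists>c. (u, c) \<in> parcs G \<and> (c, v) \<in> parcs G)" (is "?L \<longleftrightarrow> ?R")
proof
  assume ?L
  then have "graph_dist G u v \<noteq> \<infinity>" by auto
  then obtain p where p: "awalk u p v" "graph_dist G u v = ereal (real (length p))"
    by (rule graph_dist_eq_walk_length)
  with \<open>?L\<close> have "length p = 1 \<or> length p = 2"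
    by (auto simp: one_ereal_def numeral_eq_ereal)
  then show ?R using p(1) awalk_1D awalk_2D by metis
next
  assume ?R
  then obtain q where q: "awalk u q v" "length q \<le> 2"
  proof
    assume "(u, v) \<in> parcs G"
    from that[OF awalk_1[OF this]] show thesis by simp
  next
    assume "\<exists>c. (u, c) \<in> parcs G \<and> (c, v) \<in> parcs G"
    then obtain c where "(u, c) \<in> parcs G" "(c, v) \<in> parcs G" by blast
    from that[OF awalk_2[OF this]] show thesis by simp
  qed
  then have "graph_dist G u v \<noteq> \<infinity>" using graph_dist_le_walk by fastforce
  then obtain p where p: "awalk u p v" "graph_dist G u v = ereal (real (length p))"
    by (rule graph_dist_eq_walk_length)
  have "length p \<le> length q"
    using graph_dist_le_walk[OF q(1)] p(2) by simp
  moreover have "length p \<noteq> 0" using awalk_0_iff p(1) assms by blast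
  ultimately have "length p = 1 \<or> length p = 2" using q(2) by linarith
  then show ?L using p(2) by (auto simp: one_ereal_def numeral_eq_ereal)
qed

lemma graph_dist_ge_3_iff:
  assumes "u \<in> pverts G"
  shows "3 \<le> graph_dist G u v \<longleftrightarrow>
    u \<noteq> v \<and> (u, v) \<notin> parcs G \<and> (\<nexists>c. (u, c) \<in> parcs G \<and> (c, v) \<in> parcs G)" (is "?L \<longleftrightarrow> ?R")
proof -
  have "?L \<longleftrightarrow> (\<forall>p. awalk u p v \<longrightarrow> 3 \<le> length p)"
    using graph_dist_ge_iff[of 3 u v] by (simp add: numeral_eq_ereal)
  also have "\<dots> \<longleftrightarrow> ?R"
  proof
    assume *: "\<forall>p. awalk u p v \<longrightarrow> 3 \<le> length p"
    have "u \<noteq> v" using * assms by (auto simp: awalk_Nil_iff dest!: spec[of _ "[]"])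
    then show ?R using * awalk_1[of u v] awalk_2[of u _ v]
      by (metis length_Cons list.size(3) numeral_3_eq_3 not_less_eq_eq le0 One_nat_def Suc_le_mono)
  next
    assume R: ?R
    show "\<forall>p. awalk u p v \<longrightarrow> 3 \<le> length p"
    proof (intro allI impI, rule ccontr)
      fix p assume p: "awalk u p v" "\<not> 3 \<le> length p"
      then have "length p = 0 \<or> length p = 1 \<or> length p = 2" by linarith
      with R p(1) awalk_0_iff awalk_1D awalk_2D show False by metis
    qed
  qed
  finally show ?thesis .
qed

end

section \<open>Cycles of triangles and their persistence\<close>

lemma triangle_edges_inter_iff:
  assumes "finite s"
  shows "triangle_edges s \<inter> triangle_edges t \<noteq> {} \<longleftrightarrow> 2 \<le> card (s \<inter> t)"
proof
  assume "triangle_edges s \<inter> triangle_edges t \<noteq> {}"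
  then obtain e where "e \<subseteq> s \<inter> t" "card e = 2" by (auto simp: triangle_edges_def)
  then show "2 \<le> card (s \<inter> t)" using assms by (metis card_mono finite_Int)
next
  assume "2 \<le> card (s \<inter> t)"
  then obtain e where "e \<subseteq> s \<inter> t" "card e = 2" by (meson obtain_subset_with_card_n)
  then show "triangle_edges s \<inter> triangle_edges t \<noteq> {}" by (auto simp: triangle_edges_def)
qed

lemma finite_triangle: "t \<in> triangles G \<Longrightarrow> finite t"
  by (auto simp: triangles_def intro: card_ge_0_finite)

lemma parcs_triangle_graph:
  "(s, t) \<in> parcs (triangle_graph G) \<longleftrightarrow>
    s \<in> triangles G \<and> t \<in> triangles G \<and> s \<noteq> t \<and> 2 \<le> card (s \<inter> t)"
  using triangle_edges_inter_iff[OF finite_triangle, of s G t] by (auto simp: triangle_graph_def)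

lemma pverts_triangle_graph: "pverts (triangle_graph G) = triangles G"
  by (simp add: triangle_graph_def)

lemma triangle_graph_wf: "parcs (triangle_graph G) \<subseteq> pverts (triangle_graph G) \<times> pverts (triangle_graph G)"
  by (auto simp: parcs_triangle_graph pverts_triangle_graph)

lemma triangle_graph_sym: "sym (parcs (triangle_graph G))"
  by (auto simp: parcs_triangle_graph Int_commute intro!: symI)

abbreviation triangle_polygon :: "'a pair_pre_digraph \<Rightarrow> nat \<Rightarrow> (nat \<Rightarrow> 'a set) \<Rightarrow> bool" where
  "triangle_polygon G \<equiv> polygon (\<lambda>s t. (s, t) \<in> parcs (triangle_graph G))"

definition triangle_cyclic :: "'a pair_pre_digraph \<Rightarrow> bool" where
  "triangle_cyclic G \<longleftrightarrow> (\<exists>n c. triangle_polygon G n c)"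

lemma undirected_tree_triangle_graph_iff:
  "undirected_tree (triangle_graph G) \<longleftrightarrow> triangle_connected G \<and> \<not> triangle_cyclic G"
  unfolding undirected_tree_def triangle_connected_def triangle_cyclic_def
  using contains_cycle_graph_iff[OF triangle_graph_wf triangle_graph_sym] by metis

text \<open>
  A vertex map need not be injective to carry a cycle of triangles along: it only has to keep
  the triangles of the cycle nondegenerate and distinct, for then common edges are kept as well.
\<close>

lemma triangle_polygon_image:
  assumes c: "triangle_polygon H n c"
    and tri: "\<And>t. t \<in> c ` {..<n} \<Longrightarrow> f ` t \<in> triangles G"
    and inj: "inj_on ((`) f) (c ` {..<n})"
  shows "triangle_polygon G n (\<lambda>i. f ` c i)"
  unfolding polygon_def
proof (intro conjI allI impI)
  show "3 \<le> n" using c by (simp add: polygon_def)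
  have "inj_on c {..<n}" using c by (simp add: polygon_def)
  then show "inj_on (\<lambda>i. f ` c i) {..<n}"
    using comp_inj_on[of c "{..<n}" "(`) f"] inj by (simp add: comp_def)
  fix i assume "i < n"
  let ?s = "c i" and ?t = "c (Suc i mod n)"
  have "0 < n" using \<open>i < n\<close> by simp
  then have in_c: "?s \<in> c ` {..<n}" "?t \<in> c ` {..<n}" using \<open>i < n\<close> by auto
  have st: "?s \<in> triangles H" "?t \<in> triangles H" "?s \<noteq> ?t" "2 \<le> card (?s \<inter> ?t)"
    using c \<open>i < n\<close> by (auto simp: polygon_def parcs_triangle_graph)
  have "card (f ` ?s) = card ?s"
    using tri[OF in_c(1)] st(1) by (simp add: triangles_def)
  then have "inj_on f ?s" using finite_triangle[OF st(1)] by (simp add: eq_card_imp_inj_on)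
  then have "card (f ` (?s \<inter> ?t)) = card (?s \<inter> ?t)"
    by (meson card_image inf_le1 inj_on_subset)
  moreover have "card (f ` (?s \<inter> ?t)) \<le> card (f ` ?s \<inter> f ` ?t)"
    using finite_triangle[OF st(1)] by (intro card_mono) auto
  moreover have "f ` ?s \<noteq> f ` ?t" using inj in_c st(3) by (auto dest: inj_onD)
  ultimately show "(f ` ?s, f ` ?t) \<in> parcs (triangle_graph G)"
    using st(4) tri in_c by (simp add: parcs_triangle_graph)
qed

lemma triangle_cyclic_copy:
  assumes "contains_copy G H" "triangle_cyclic H"
  shows "triangle_cyclic G"
proof -
  from assms(1) obtain f where f: "inj_on f (pverts H)" "f ` pverts H \<subseteq> pverts G"
    "\<And>a b. (a, b) \<in> parcs H \<Longrightarrow> (f a, f b) \<in> parcs G"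
    by (rule contains_copyE) (rule that)
  from assms(2) obtain n c where c: "triangle_polygon H n c"
    by (auto simp: triangle_cyclic_def)
  have sub: "c ` {..<n} \<subseteq> triangles H"
    using c by (auto simp: polygon_def parcs_triangle_graph)
  have "f ` t \<in> triangles G" if "t \<in> c ` {..<n}" for t
  proof -
    have t: "t \<subseteq> pverts H" "card t = 3" "\<forall>u\<in>t. \<forall>v\<in>t. u \<noteq> v \<longrightarrow> (u, v) \<in> parcs H"
      using that sub by (auto simp: triangles_def)
    then have "card (f ` t) = 3" using f(1) by (metis card_image inj_on_subset)
    moreover have "f ` t \<subseteq> pverts G" using t(1) f(2) by blast
    moreover have "(y, z) \<in> parcs G" if "y \<in> f ` t" "z \<in> f ` t" "y \<noteq> z" for y z
      using that t(3) by (elim imageE) (auto intro!: f(3))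
    ultimately show ?thesis by (simp add: triangles_def)
  qed
  moreover have "inj_on ((`) f) (c ` {..<n})"
    using f(1) sub by (intro inj_on_subset[OF inj_on_image_Pow]) (auto simp: triangles_def)
  ultimately show ?thesis
    unfolding triangle_cyclic_def by (blast intro: triangle_polygon_image[OF c])
qed

lemma triangle_insertI:
  assumes "distinct [a, b, c]" "{a, b, c} \<subseteq> pverts G"
    "(a, b) \<in> parcs G" "(b, a) \<in> parcs G" "(a, c) \<in> parcs G" "(c, a) \<in> parcs G"
    "(b, c) \<in> parcs G" "(c, b) \<in> parcs G"
  shows "{a, b, c} \<in> triangles G"
  using assms by (auto simp: triangles_def)

lemma card_inter_ge_2I:
  assumes "a \<noteq> b" "a \<in> s" "b \<in> s" "a \<in> t" "b \<in> t" "finite s"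
  shows "2 \<le> card (s \<inter> t)"
proof -
  have "card {a, b} \<le> card (s \<inter> t)" using assms by (intro card_mono) auto
  then show ?thesis using assms(1) by simp
qed

subsection \<open>The fixed forbidden graphs\<close>

lemma Suc_mod_eq: "i < n \<Longrightarrow> Suc i mod n = (if Suc i = n then 0 else Suc i)"
  by auto

lemma parcs_wheel_graph:
  "(a, b) \<in> parcs (wheel_graph n) \<longleftrightarrow> (a, b) \<in> parcs (cycle_graph n) \<or>
    a < n \<and> b = n \<or> a = n \<and> b < n"
  and pverts_wheel_graph: "pverts (wheel_graph n) = {..n}"
  by (auto simp: wheel_graph_def graph_join_def complete_graph_def cycle_graph_def)

lemma triangle_cyclic_wheel:
  assumes "3 \<le> n"
  shows "triangle_cyclic (wheel_graph n)"
proof -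
  let ?c = "\<lambda>i. {n, i, Suc i mod n}"
  have tri: "?c i \<in> triangles (wheel_graph n)" if "i < n" for i
    using that assms
    by (intro triangle_insertI)
       (auto simp: parcs_wheel_graph pverts_wheel_graph parcs_cycle_graph Suc_mod_eq)
  have inj: "i = j" if "?c i = ?c j" "i < n" "j < n" for i j
  proof (rule ccontr)
    assume "i \<noteq> j"
    have "i \<in> ?c j" "j \<in> ?c i" using that by auto
    then show False using that(2,3) \<open>i \<noteq> j\<close> assms by (auto simp: Suc_mod_eq split: if_splits)
  qed
  have "triangle_polygon (wheel_graph n) n ?c"
    unfolding polygon_def
  proof (intro conjI allI impI)
    show "inj_on ?c {..<n}" by (intro inj_onI) (blast intro: inj)
    fix i assume i: "i < n"
    have "i \<noteq> Suc i mod n" using i assms by (auto simp: Suc_mod_eq)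
    then have "?c i \<noteq> ?c (Suc i mod n)" using inj[of i "Suc i mod n"] i by force
    moreover have "2 \<le> card (?c i \<inter> ?c (Suc i mod n))"
      using i by (intro card_inter_ge_2I[of n "Suc i mod n"]) (auto simp: Suc_mod_eq)
    ultimately show "(?c i, ?c (Suc i mod n)) \<in> parcs (triangle_graph (wheel_graph n))"
      using tri i by (simp add: parcs_triangle_graph)
  qed (rule assms)
  then show ?thesis by (auto simp: triangle_cyclic_def)
qed

lemma triangle_cyclic_K5_minus_K3: "triangle_cyclic K5_minus_K3"
proof -
  let ?c = "\<lambda>i. {3 :: nat, 4, i}"
  have tri: "?c i \<in> triangles K5_minus_K3" if "i < 3" for i
    using that
    by (intro triangle_insertI) (auto simp: K5_minus_K3_def delete_edges_def complete_graph_def)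
  have "triangle_polygon K5_minus_K3 3 ?c"
    unfolding polygon_def
  proof (intro conjI allI impI)
    show "inj_on ?c {..<3}"
    proof (rule inj_onI)
      fix i j :: nat assume ij: "i \<in> {..<3}" "j \<in> {..<3}" "?c i = ?c j"
      then have "i \<in> {3, 4, j}" by blast
      then show "i = j" using ij by simp
    qed
    fix i :: nat assume i: "i < 3"
    have "i \<noteq> Suc i mod 3" using i by (auto simp: Suc_mod_eq)
    moreover have "i \<noteq> 3" "i \<noteq> 4" "Suc i mod 3 < 3" using i by auto
    ultimately have "i \<notin> ?c (Suc i mod 3)" by simp
    then have "?c i \<noteq> ?c (Suc i mod 3)" by blast
    moreover have "2 \<le> card (?c i \<inter> ?c (Suc i mod 3))"
      by (intro card_inter_ge_2I[of 3 4]) auto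
    ultimately show "(?c i, ?c (Suc i mod 3)) \<in> parcs (triangle_graph K5_minus_K3)"
      using tri i by (simp add: parcs_triangle_graph)
  qed simp
  then show ?thesis by (auto simp: triangle_cyclic_def)
qed

lemma cycle_graph_wf: "parcs (cycle_graph n) \<subseteq> pverts (cycle_graph n) \<times> pverts (cycle_graph n)"
  by (auto simp: parcs_cycle_graph pverts_cycle_graph)

lemma pverts_square_cycle: "pverts (graph_square (cycle_graph n)) = {..<n}"
  by (simp add: graph_square_def pverts_cycle_graph)

lemma graph_dist_self:
  assumes "parcs G \<subseteq> pverts G \<times> pverts G" "u \<in> pverts G"
  shows "graph_dist G u u \<le> 0"
proof -
  interpret wf_digraph "with_proj G" using assms(1) by (simp add: wf_digraph_with_proj_iff)
  have "awalk u [] u" using assms(2) by (simp add: awalk_Nil_iff)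
  from graph_dist_le_walk[OF assms(1) this] show ?thesis by (simp add: zero_ereal_def)
qed

lemma parcs_square_cycle:
  assumes "3 \<le> n"
  shows "(i, j) \<in> parcs (graph_square (cycle_graph n)) \<longleftrightarrow> i < n \<and> j < n \<and> i \<noteq> j \<and>
    (j = Suc i mod n \<or> i = Suc j mod n \<or> j = Suc (Suc i mod n) mod n \<or> i = Suc (Suc j mod n) mod n)"
    (is "_ \<longleftrightarrow> i < n \<and> j < n \<and> i \<noteq> j \<and> ?P")
proof (cases "i < n \<and> j < n \<and> i \<noteq> j")
  case True
  then have ij: "i < n" "j < n" "i \<noteq> j" by auto
  have "(i, j) \<in> parcs (graph_square (cycle_graph n)) \<longleftrightarrow>
      (i, j) \<in> parcs (cycle_graph n) \<or>
      (\<exists>k. (i, k) \<in> parcs (cycle_graph n) \<and> (k, j) \<in> parcs (cycle_graph n))"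
    using ij graph_dist_1_or_2_iff[OF cycle_graph_wf ij(3), of n]
    by (simp add: graph_square_def pverts_cycle_graph)
  also have "\<dots> \<longleftrightarrow> ?P"
  proof
    assume "(i, j) \<in> parcs (cycle_graph n) \<or>
      (\<exists>k. (i, k) \<in> parcs (cycle_graph n) \<and> (k, j) \<in> parcs (cycle_graph n))"
    then show ?P using ij by (auto simp: parcs_cycle_graph Suc_mod_eq split: if_splits)
  next
    let ?C = "parcs (cycle_graph n)"
    have *: "(i, Suc i mod n) \<in> ?C" "(Suc j mod n, j) \<in> ?C"
      "j = Suc (Suc i mod n) mod n \<Longrightarrow> (Suc i mod n, j) \<in> ?C"
      "i = Suc (Suc j mod n) mod n \<Longrightarrow> (i, Suc j mod n) \<in> ?C"
      using ij by (auto simp: parcs_cycle_graph)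
    assume ?P
    then show "(i, j) \<in> ?C \<or> (\<exists>k. (i, k) \<in> ?C \<and> (k, j) \<in> ?C)"
      using * by metis
  qed
  finally show ?thesis using ij by simp
next
  case False
  moreover have "(i, i) \<notin> parcs (graph_square (cycle_graph n))"
    using graph_dist_self[OF cycle_graph_wf, of i n]
    by (auto simp: graph_square_def one_ereal_def)
  moreover have "i < n \<and> j < n" if "(i, j) \<in> parcs (graph_square (cycle_graph n))"
    using that by (simp add: graph_square_def pverts_cycle_graph)
  ultimately show ?thesis by metis
qed

lemma triangle_cyclic_square_cycle:
  assumes "5 \<le> n"
  shows "triangle_cyclic (graph_square (cycle_graph n))"
proof -
  let ?c = "\<lambda>i. {i, Suc i mod n, Suc (Suc i mod n) mod n}"
  have tri: "?c i \<in> triangles (graph_square (cycle_graph n))" if "i < n" for i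
    using that assms
    by (intro triangle_insertI)
       (auto simp: parcs_square_cycle pverts_square_cycle Suc_mod_eq split: if_splits)
  have inj: "i = j" if "?c i = ?c j" "i < n" "j < n" for i j
  proof (rule ccontr)
    assume "i \<noteq> j"
    have "i \<in> ?c j" "j \<in> ?c i" using that(1) by auto
    then show False using that(2,3) \<open>i \<noteq> j\<close> assms by (auto simp: Suc_mod_eq split: if_splits)
  qed
  have "triangle_polygon (graph_square (cycle_graph n)) n ?c"
    unfolding polygon_def
  proof (intro conjI allI impI)
    show "inj_on ?c {..<n}" by (intro inj_onI) (blast intro: inj)
    fix i assume i: "i < n"
    let ?j = "Suc i mod n"
    have j: "?j < n" "i \<noteq> ?j" using i assms by (auto simp: Suc_mod_eq)
    then have "?c i \<noteq> ?c ?j" using inj[of i ?j] i by blast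
    moreover have "2 \<le> card (?c i \<inter> ?c ?j)"
      using i assms by (intro card_inter_ge_2I[of ?j "Suc ?j mod n"]) (auto simp: Suc_mod_eq)
    ultimately show "(?c i, ?c ?j) \<in> parcs (triangle_graph (graph_square (cycle_graph n)))"
      using tri i j by (simp add: parcs_triangle_graph)
  qed (use assms in simp)
  then show ?thesis by (auto simp: triangle_cyclic_def)
qed

lemma contains_wheelI:
  assumes G: "parcs G \<subseteq> pverts G \<times> pverts G" "sym (parcs G)" and n: "3 \<le> n"
    and y: "inj_on y {..<n}" "x \<notin> y ` {..<n}"
    and spoke: "\<And>i. i < n \<Longrightarrow> (x, y i) \<in> parcs G"
    and rim: "\<And>i. i < n \<Longrightarrow> (y i, y (Suc i mod n)) \<in> parcs G"
  shows "contains_copy G (wheel_graph n)"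
proof (rule contains_copyI[of _ _ "\<lambda>i. if i = n then x else y i"])
  have "0 < n" using n by simp
  show "inj_on (\<lambda>i. if i = n then x else y i) (pverts (wheel_graph n))"
    using y by (auto simp: inj_on_def pverts_wheel_graph image_iff le_less)
  show "(\<lambda>i. if i = n then x else y i) ` pverts (wheel_graph n) \<subseteq> pverts G"
  proof -
    have "x \<in> pverts G" "y i \<in> pverts G" if "i < n" for i
      using subsetD[OF G(1) spoke[OF that]] by auto
    then show ?thesis using \<open>0 < n\<close> by (auto simp: pverts_wheel_graph le_less)
  qed
  show "(if a = n then x else y a, if b = n then x else y b) \<in> parcs G"
    if "(a, b) \<in> parcs (wheel_graph n)" for a b
  proof -
    have "a < n \<and> b < n \<and> (b = Suc a mod n \<or> a = Suc b mod n) \<or> a < n \<and> b = n \<or> a = n \<and> b < n"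
      using that by (simp add: parcs_wheel_graph parcs_cycle_graph)
    then show ?thesis using spoke rim symD[OF G(2)] by (elim disjE conjE) simp_all
  qed
qed (use G in \<open>auto simp: parcs_wheel_graph pverts_wheel_graph parcs_cycle_graph\<close>)

lemma contains_K4I:
  assumes G: "parcs G \<subseteq> pverts G \<times> pverts G" "sym (parcs G)" and d: "distinct [a, b, c, d]"
    and e: "(a, b) \<in> parcs G" "(a, c) \<in> parcs G" "(a, d) \<in> parcs G" "(b, c) \<in> parcs G"
      "(b, d) \<in> parcs G" "(c, d) \<in> parcs G"
  shows "contains_copy G (wheel_graph 3)"
proof (rule contains_wheelI[OF G, of 3 "\<lambda>i. [b, c, d] ! i" a])
  fix i :: nat assume "i < 3"
  then have i: "i = 0 \<or> i = 1 \<or> i = 2" by auto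
  then show "(a, [b, c, d] ! i) \<in> parcs G" using e by (elim disjE) simp_all
  show "([b, c, d] ! i, [b, c, d] ! (Suc i mod 3)) \<in> parcs G"
    using i e symD[OF G(2) e(5)] symD[OF G(2) e(6)] by (elim disjE) (simp_all add: numeral_2_eq_2)
next
  show "inj_on (\<lambda>i. [b, c, d] ! i) {..<3}"
    using d by (intro inj_on_nth) auto
  show "a \<notin> (!) [b, c, d] ` {..<3}"
    using d by (auto simp: lessThan_Suc numeral_3_eq_3)
qed simp

lemma sym_K6_minus: "sym (parcs K6_minus_K3)" "sym (parcs K6_minus_P4)"
  by (auto simp: K6_minus_K3_def K6_minus_P4_def delete_edges_def complete_graph_def
      path_graph_def intro!: symI)

lemma K4_in_K6_minus_K3: "contains_copy K6_minus_K3 (wheel_graph 3)"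
  by (rule contains_K4I[of _ 0 3 4 5, OF _ sym_K6_minus(1)])
    (auto simp: K6_minus_K3_def delete_edges_def complete_graph_def)

lemma K4_in_K6_minus_P4: "contains_copy K6_minus_P4 (wheel_graph 3)"
  by (rule contains_K4I[of _ 0 2 4 5, OF _ sym_K6_minus(2)])
    (auto simp: K6_minus_P4_def delete_edges_def complete_graph_def path_graph_def)

subsection \<open>The weak operations\<close>

definition simple_graph :: "'a pair_pre_digraph \<Rightarrow> bool" where
  "simple_graph H \<longleftrightarrow> parcs H \<subseteq> pverts H \<times> pverts H \<and> sym (parcs H) \<and> irrefl (parcs H)"

lemma specified_cycle_triangles:
  assumes "specified_cycle H S" "t \<in> S"
  shows "t \<in> triangles H"
  using assms by (auto simp: specified_cycle_def induced_cycle_def pverts_triangle_graph)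

lemma simple_graph_split_edge:
  assumes "simple_graph H" "{u, v, x} \<in> triangles H" "u \<noteq> v" "x \<notin> {u, v}" "w \<notin> pverts H"
  shows "simple_graph (split_edge H u v x w)"
  using assms unfolding simple_graph_def split_edge_def triangles_def sym_def irrefl_def
  by auto

lemma simple_graph_stick_vertices:
  assumes H: "simple_graph H" and uv: "u \<in> pverts H" "v \<in> pverts H" "3 \<le> graph_dist H u v"
    and w: "w \<notin> pverts H"
  shows "simple_graph (stick_vertices H u v w)"
proof -
  have "u \<noteq> v" "(u, v) \<notin> parcs H"
    using graph_dist_ge_3_iff[of H u v] uv H by (auto simp: simple_graph_def)
  then show ?thesis
    using H w unfolding simple_graph_def stick_vertices_def sym_def irrefl_def Let_def by auto
qed

lemma weakly_derived_simple:
  assumes "weakly_derived H S"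
  shows "simple_graph H"
  using assms
proof (induction rule: weakly_derived.induct)
  case (square m H S)
  then have "3 \<le> m" by simp
  then show ?case unfolding square(2) simple_graph_def
    by (auto simp: parcs_square_cycle pverts_square_cycle sym_def irrefl_def)
next
  case (K6_K3 H S)
  then show ?case
    by (auto simp: simple_graph_def K6_minus_K3_def delete_edges_def complete_graph_def sym_def
        irrefl_def)
next
  case (K6_P4 H S)
  then show ?case
    by (auto simp: simple_graph_def K6_minus_P4_def delete_edges_def complete_graph_def
        path_graph_def sym_def irrefl_def)
next
  case (split H S u v x w)
  then show ?case using specified_cycle_triangles by (intro simple_graph_split_edge) blast+
next
  case (stick H S u v w)
  then show ?case by (intro simple_graph_stick_vertices) auto
qed

text \<open>
  Let \<open>p\<close> and \<open>q\<close> be the neighbours of the split triangle \<open>uvx\<close> on the cycle. As \<open>uv\<close> is private,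
  each of them contains \<open>ux\<close> or \<open>vx\<close>. If they contain different ones, the two new triangles take
  the place of \<open>uvx\<close>. If they contain the same one, they are adjacent themselves, and \<open>uvx\<close> can
  be skipped; the cycle has length at least \<open>4\<close> then, because three triangles with a common edge
  do not form a specified cycle.
\<close>

lemma triangle_cyclic_split_edge:
  assumes cyc: "specified_cycle H S" and t: "{u, v, x} \<in> S" and uvx: "u \<noteq> v" "x \<notin> {u, v}"
    and priv: "private_edge S {u, v}" and w: "w \<notin> pverts H"
  shows "triangle_cyclic (split_edge H u v x w)"
proof -
  let ?H = "split_edge H u v x w" and ?t = "{u, v, x}"
  from cyc obtain c' where c': "triangle_polygon H (card S) c'" "c' ` {..<card S} = S"
    unfolding specified_cycle_def by (auto elim: induced_cycleE)
  define n where "n = card S"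
  obtain k where k: "k < n" "c' k = ?t" using c'(2) t unfolding n_def by (metis imageE lessThan_iff)
  define c where "c i = c' ((i + Suc k) mod n)" for i
  have c: "triangle_polygon H n c" "c ` {..<n} = S"
    using polygon_rotate[OF c'(1), of "Suc k"] c'(2) unfolding c_def n_def by auto
  note n3 = polygonD(1)[OF c(1)] and inj = polygonD(2)[OF c(1)]
  have last: "c (n - 1) = ?t" using k by (simp add: c_def)
  let ?p = "c (n - 2)" and ?q = "c 0"
  have p_adj: "(?p, ?t) \<in> parcs (triangle_graph H)" and q_adj: "(?t, ?q) \<in> parcs (triangle_graph H)"
    using polygonD(3)[OF c(1), of "n - 2"] polygonD(4)[OF c(1)] n3 last
    by (auto simp: numeral_2_eq_2 Suc_diff_Suc)
  have "?p \<noteq> ?q" using inj n3 by (auto dest: inj_onD)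
  have other: "\<not> {u, v} \<subseteq> s" if "s \<in> S" "s \<noteq> ?t" for s
    using priv t that uvx by (auto simp: private_edge_def triangle_edges_def)
  have in_S: "c i \<in> S" if "i < n" for i using c(2) that by blast
  have not_t: "c i \<noteq> ?t" if "i < n - 1" for i
    using inj that last by (auto dest: inj_onD[of c _ i "n - 1"])
  have keep: "s \<in> triangles ?H" if "s \<in> S" "s \<noteq> ?t" for s
    using specified_cycle_triangles[OF cyc that(1)] other[OF that]
    by (auto simp: triangles_def split_edge_def)
  have keep_adj: "(c i, c j) \<in> parcs (triangle_graph ?H)"
    if "(c i, c j) \<in> parcs (triangle_graph H)" "i < n - 1" "j < n - 1" for i j
    using that keep in_S not_t by (simp add: parcs_triangle_graph)
  have tH: "?t \<in> triangles H" using specified_cycle_triangles[OF cyc t] .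
  then have "{u, v, x} \<subseteq> pverts H" and e: "(u, x) \<in> parcs H" "(x, u) \<in> parcs H" "(v, x) \<in> parcs H" "(x, v) \<in> parcs H"
    using uvx by (auto simp: triangles_def)
  then have wuvx: "w \<noteq> u" "w \<noteq> v" "w \<noteq> x" using w by auto
  let ?t1 = "{u, w, x}" and ?t2 = "{w, v, x}"
  have new_tri: "?t1 \<in> triangles ?H" "?t2 \<in> triangles ?H"
    using e \<open>{u, v, x} \<subseteq> pverts H\<close> wuvx uvx
    by (auto intro!: triangle_insertI simp: split_edge_def)
  have fresh: "?t1 \<notin> S" "?t2 \<notin> S"
    using w specified_cycle_triangles[OF cyc] by (auto simp: triangles_def)
  \<comment> \<open>\<open>p\<close> and \<open>q\<close> are neighbours of \<open>uvx\<close> and avoid its private edge \<open>uv\<close>\<close>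
  have share: "{u, x} \<subseteq> s \<or> {v, x} \<subseteq> s"
    if "s \<in> S" "s \<noteq> ?t" "2 \<le> card (s \<inter> ?t)" for s
  proof -
    have "s \<inter> ?t \<subseteq> {u}" if "x \<notin> s" "v \<notin> s" using that by auto
    moreover have "s \<inter> ?t \<subseteq> {v}" if "x \<notin> s" "u \<notin> s" using that by auto
    moreover have "s \<inter> ?t \<subseteq> {x}" if "v \<notin> s" "u \<notin> s" using that by auto
    ultimately show ?thesis
      using that(3) other[OF that(1,2)] card_mono[of "{_}" "s \<inter> ?t"] by fastforce
  qed
  have pq: "?p \<in> S" "?q \<in> S" "?p \<noteq> ?t" "?q \<noteq> ?t"
    using in_S not_t n3 p_adj q_adj by (auto simp: parcs_triangle_graph)
  \<comment> \<open>the new cycle, when \<open>p\<close> and \<open>q\<close> share different edges with \<open>uvx\<close>\<close>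
  have insert: "triangle_cyclic ?H"
    if ab: "a \<noteq> b" "a \<in> triangles ?H" "b \<in> triangles ?H" "a \<notin> S" "b \<notin> S"
      and pa: "2 \<le> card (?p \<inter> a)" and abi: "2 \<le> card (a \<inter> b)" and bq: "2 \<le> card (b \<inter> ?q)" for a b
  proof -
    let ?d = "c(n - 1 := a, n := b)"
    have "triangle_polygon ?H (Suc n) ?d"
    proof (rule polygonI)
      show "inj_on ?d {..<Suc n}"
      proof (rule inj_onI)
        fix i j assume ij: "i \<in> {..<Suc n}" "j \<in> {..<Suc n}" "?d i = ?d j"
        have "c i \<in> S" if "i < n" for i using in_S that .
        then show "i = j" using ij ab inj_onD[OF inj, of i j]
          by (auto simp: less_Suc_eq split: if_splits)
      qed
      fix i assume i: "Suc i < Suc n"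
      consider "Suc i < n - 1" | "Suc i = n - 1" | "i = n - 1" using i by linarith
      then show "(?d i, ?d (Suc i)) \<in> parcs (triangle_graph ?H)"
      proof cases
        case 1
        then have "?d i = c i" "?d (Suc i) = c (Suc i)" "Suc i < n" by auto
        then show ?thesis using 1 keep_adj[of i "Suc i"] polygonD(3)[OF c(1), of i] by simp
      next
        case 2
        then have "i = n - 2" by simp
        then show ?thesis using 2 n3 pa ab pq keep by (auto simp: parcs_triangle_graph)
      next
        case 3
        then show ?thesis using n3 abi ab by (auto simp: parcs_triangle_graph)
      qed
    qed (use n3 bq ab pq keep in \<open>auto simp: parcs_triangle_graph\<close>)
    then show ?thesis by (auto simp: triangle_cyclic_def)
  qed
  have t12: "?t1 \<noteq> ?t2" "2 \<le> card (?t1 \<inter> ?t2)" "2 \<le> card (?t2 \<inter> ?t1)"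
    using uvx wuvx card_inter_ge_2I[of w x ?t1 ?t2] by (auto simp: Int_commute)
  have skip: "triangle_cyclic ?H" if y: "y \<in> {u, v}" "{y, x} \<subseteq> ?p" "{y, x} \<subseteq> ?q" for y
  proof -
    have yx: "y \<noteq> x" using y(1) uvx by auto
    have "n \<noteq> 3"
    proof
      assume "n = 3"
      then have "S = {?q, ?p, ?t}" using c(2) last by (auto simp: lessThan_Suc numeral_3_eq_3 insert_commute)
      then have "\<forall>s\<in>S. {y, x} \<in> triangle_edges s" using y yx by (auto simp: triangle_edges_def)
      then show False using cyc \<open>n = 3\<close> unfolding specified_cycle_def n_def by blast
    qed
    with n3 have n4: "4 \<le> n" by simp
    have "triangle_polygon ?H (n - 1) c"
    proof (rule polygonI)
      show "inj_on c {..<n - 1}" using inj by (rule inj_on_subset) auto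
      show "(c i, c (Suc i)) \<in> parcs (triangle_graph ?H)" if "Suc i < n - 1" for i
        using that keep_adj[of i "Suc i"] polygonD(3)[OF c(1), of i] by simp
      have "2 \<le> card (?p \<inter> ?q)"
        using y yx finite_triangle[OF specified_cycle_triangles[OF cyc pq(1)]]
        by (intro card_inter_ge_2I[of y x]) auto
      then show "(c (n - 1 - 1), c 0) \<in> parcs (triangle_graph ?H)"
        using pq keep \<open>?p \<noteq> ?q\<close> by (simp add: parcs_triangle_graph numeral_2_eq_2)
    qed (use n4 in simp)
    then show ?thesis by (auto simp: triangle_cyclic_def)
  qed
  have fin: "finite ?p" "finite ?q"
    using finite_triangle specified_cycle_triangles[OF cyc] pq by blast+
  consider "{u, x} \<subseteq> ?p" "{v, x} \<subseteq> ?q" | "{v, x} \<subseteq> ?p" "{u, x} \<subseteq> ?q"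
    | y where "y \<in> {u, v}" "{y, x} \<subseteq> ?p" "{y, x} \<subseteq> ?q"
    using share[OF pq(1,3)] share[OF pq(2,4)] p_adj q_adj
    by (auto simp: parcs_triangle_graph Int_commute)
  then show ?thesis
  proof cases
    case 1
    have "2 \<le> card (?p \<inter> ?t1)"
      by (rule card_inter_ge_2I[of u x]) (use 1 fin uvx in auto)
    moreover have "2 \<le> card (?t2 \<inter> ?q)"
      by (rule card_inter_ge_2I[of v x]) (use 1 fin uvx in auto)
    ultimately show ?thesis using insert[of ?t1 ?t2] new_tri fresh t12 by blast
  next
    case 2
    have "2 \<le> card (?p \<inter> ?t2)"
      by (rule card_inter_ge_2I[of v x]) (use 2 fin uvx in auto)
    moreover have "2 \<le> card (?t1 \<inter> ?q)"
      by (rule card_inter_ge_2I[of u x]) (use 2 fin uvx in auto)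
    ultimately show ?thesis using insert[of ?t2 ?t1] new_tri fresh t12 by blast
  next
    case 3
    then show ?thesis by (rule skip)
  qed
qed

text \<open>
  Two triangles become equal under sticking only if they are \<open>uab\<close> and \<open>vab\<close>, and then \<open>u\<close> and
  \<open>v\<close> have distance at most \<open>2\<close>.
\<close>

lemma triangle_cyclic_stick_vertices:
  assumes H: "simple_graph H" and cyc: "specified_cycle H S"
    and uv: "u \<in> pverts H" "v \<in> pverts H" "3 \<le> graph_dist H u v" and w: "w \<notin> pverts H"
  shows "triangle_cyclic (stick_vertices H u v w)"
proof -
  let ?f = "\<lambda>z. if z = u \<or> z = v then w else z"
  have far: "u \<noteq> v" "(u, v) \<notin> parcs H" "\<And>c. (u, c) \<in> parcs H \<Longrightarrow> (c, v) \<notin> parcs H"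
    using graph_dist_ge_3_iff[of H u v] uv H by (auto simp: simple_graph_def)
  from cyc obtain c where c: "triangle_polygon H (card S) c" "c ` {..<card S} = S"
    unfolding specified_cycle_def by (auto elim: induced_cycleE)
  have one: "\<not> (u \<in> t \<and> v \<in> t)" "w \<notin> t" if "t \<in> triangles H" for t
    using that far w by (auto simp: triangles_def)
  have inj_t: "inj_on ?f t" if "t \<in> triangles H" for t
    using one[OF that] by (auto simp: inj_on_def)
  have tri: "?f ` t \<in> triangles (stick_vertices H u v w)" if "t \<in> triangles H" for t
  proof -
    have t: "t \<subseteq> pverts H" "card t = 3" "\<And>a b. a \<in> t \<Longrightarrow> b \<in> t \<Longrightarrow> a \<noteq> b \<Longrightarrow> (a, b) \<in> parcs H"
      using that by (auto simp: triangles_def)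
    have "card (?f ` t) = 3" using card_image[OF inj_t[OF that]] t(2) by (rule trans)
    moreover have "(?f a, ?f b) \<in> parcs (stick_vertices H u v w)"
      if ab: "a \<in> t" "b \<in> t" "?f a \<noteq> ?f b" for a b
    proof -
      have "(a, b) \<in> parcs H" "(b, a) \<in> parcs H" using t(3) ab by auto
      then show ?thesis using ab(3) by (auto simp: stick_vertices_def Let_def)
    qed
    moreover have "?f ` t \<subseteq> pverts (stick_vertices H u v w)"
      using t(1) by (auto simp: stick_vertices_def Let_def)
    ultimately show ?thesis unfolding triangles_def by blast
  qed
  have inj: "inj_on ((`) ?f) (triangles H)"
  proof (rule inj_onI)
    have *: "s \<subseteq> t" if st: "s \<in> triangles H" "t \<in> triangles H" "?f ` s = ?f ` t" for s t
    proof
      fix z assume z: "z \<in> s"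
      have "?f z \<in> ?f ` t" using z st(3) by blast
      then obtain z' where z': "z' \<in> t" "?f z = ?f z'" by auto
      show "z \<in> t"
      proof (rule ccontr)
        assume "z \<notin> t"
        then have zz: "z \<noteq> z'" "z \<in> {u, v}" "z' \<in> {u, v}"
          using z z' one(2)[OF st(1)] one(2)[OF st(2)] by (auto split: if_splits)
        have "card s = 3" using st(1) by (simp add: triangles_def)
        then have "\<not> s \<subseteq> {z}" by (auto dest: subset_singletonD)
        then obtain a where a: "a \<in> s" "a \<noteq> z" by auto
        then have "a \<noteq> u" "a \<noteq> v" using one(1)[OF st(1)] z zz by auto
        moreover have "?f a \<in> ?f ` t" using a st(3) by blast
        ultimately have "a \<in> t" using one(2)[OF st(1)] a by (auto split: if_splits)
        then have "(z, a) \<in> parcs H" "(a, z') \<in> parcs H" "(a, z) \<in> parcs H" "(z', a) \<in> parcs H"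
          using a z z' st \<open>a \<noteq> u\<close> \<open>a \<noteq> v\<close> zz by (auto simp: triangles_def)
        then show False using far(3) zz by auto
      qed
    qed
    fix s t assume st: "s \<in> triangles H" "t \<in> triangles H" "?f ` s = ?f ` t"
    from *[OF st] *[OF st(2,1) st(3)[symmetric]] show "s = t" by (rule subset_antisym)
  qed
  have S: "S \<subseteq> triangles H" using specified_cycle_triangles[OF cyc] by blast
  have "triangle_polygon (stick_vertices H u v w) (card S) (\<lambda>i. ?f ` c i)"
    by (rule triangle_polygon_image[OF c(1)]) (use c(2) S tri inj_on_subset[OF inj] in auto)
  then show ?thesis by (auto simp: triangle_cyclic_def)
qed

lemma triangle_cyclic_weakly_derived:
  assumes "weakly_derived H S"
  shows "triangle_cyclic H"
  using assms
proof (cases rule: weakly_derived.cases)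
  case (split H' S' u v x w)
  then show ?thesis using triangle_cyclic_split_edge by metis
next
  case (stick H' S' u v w)
  then show ?thesis using triangle_cyclic_stick_vertices weakly_derived_simple by metis
qed (auto simp: triangle_cyclic_def elim!: induced_cycleE)

section \<open>Cyclic strips of triangles\<close>

lemma two_le_card_iff: "finite A \<Longrightarrow> 2 \<le> card A \<longleftrightarrow> (\<exists>a\<in>A. \<exists>b\<in>A. a \<noteq> b)"
  using card_le_Suc0_iff_eq[of A] by (auto simp: not_less_eq_eq[symmetric] numeral_2_eq_2)

text \<open>
  An induced cycle of length \<open>m \<ge> 4\<close> in a triangle graph, unrolled to a periodic sequence so that
  all positions can be shifted freely. The last conjunct is inducedness: triangles that share an
  edge are neighbours on the cycle.
\<close>

definition triangle_strip :: "nat \<Rightarrow> (nat \<Rightarrow> 'a set) \<Rightarrow> bool" where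
  "triangle_strip m t \<longleftrightarrow> 4 \<le> m \<and> (\<forall>i. t (i + m) = t i) \<and> (\<forall>i. card (t i) = 3) \<and>
    (\<forall>i. 2 \<le> card (t i \<inter> t (Suc i))) \<and>
    (\<forall>i j. i < j \<and> j < i + m \<and> 2 \<le> card (t i \<inter> t j) \<longrightarrow> j = Suc i \<or> Suc j = i + m)"

text \<open>
  The triangles through a vertex are consecutive iff within one period there is at most one
  position after which the vertex is dropped.
\<close>

definition single_runs :: "nat \<Rightarrow> (nat \<Rightarrow> 'a set) \<Rightarrow> bool" where
  "single_runs m t \<longleftrightarrow> (\<forall>z i j. i < j \<and> j < i + m \<longrightarrow>
     \<not> (z \<in> t i \<and> z \<notin> t (Suc i) \<and> z \<in> t j \<and> z \<notin> t (Suc j)))"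

text \<open>
  The middle triangles \<open>uwx\<close>, \<open>wvx\<close> of four consecutive triangles through \<open>x\<close>. They are what a
  weak edge splitting of the edge \<open>uv\<close> of a triangle \<open>uvx\<close> produces.
\<close>

definition fan :: "(nat \<Rightarrow> 'a set) \<Rightarrow> 'a \<Rightarrow> 'a \<Rightarrow> 'a \<Rightarrow> 'a \<Rightarrow> bool" where
  "fan t u w v x \<longleftrightarrow> distinct [u, w, v, x] \<and> {u, x} \<subseteq> t 0 \<and> t 1 = {u, w, x} \<and>
    t 2 = {w, v, x} \<and> {v, x} \<subseteq> t 3"

text \<open>No fan can be contracted, as the edge that would replace it is present already.\<close>

definition unsplittable :: "(nat \<Rightarrow> 'a set) \<Rightarrow> bool" where
  "unsplittable t \<longleftrightarrow>
    (\<forall>k u w v x. fan (\<lambda>i. t (i + k)) u w v x \<longrightarrow> (\<exists>j. {u, v} \<subseteq> t j))"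

text \<open>
  One period determines a strip; the wrap-around shows up as the pair of its first and last triangle.
\<close>

lemma triangle_stripI:
  assumes "4 \<le> m" and card: "\<And>i. i < m \<Longrightarrow> card (s i) = 3"
    and step: "\<And>i. Suc i < m \<Longrightarrow> 2 \<le> card (s i \<inter> s (Suc i))" "2 \<le> card (s (m - 1) \<inter> s 0)"
    and far: "\<And>i j. i < j \<Longrightarrow> j < m \<Longrightarrow> 2 \<le> card (s i \<inter> s j) \<Longrightarrow> j = Suc i \<or> i = 0 \<and> j = m - 1"
  shows "triangle_strip m (\<lambda>i. s (i mod m))" "range (\<lambda>i. s (i mod m)) = s ` {..<m}"
proof -
  have "2 \<le> card (s (i mod m) \<inter> s (Suc i mod m))" for i
  proof (cases "Suc (i mod m) = m")
    case True
    then have "i mod m = m - 1" "Suc i mod m = 0" by (auto simp: mod_Suc)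
    then show ?thesis using step(2) by simp
  next
    case False
    then have "Suc i mod m = Suc (i mod m)" by (simp add: mod_Suc)
    moreover have "i mod m < m" using \<open>4 \<le> m\<close> by simp
    ultimately show ?thesis using step(1)[of "i mod m"] False by simp
  qed
  moreover have "j = Suc i \<or> Suc j = i + m"
    if "i < j" "j < i + m" "2 \<le> card (s (i mod m) \<inter> s (j mod m))" for i j
  proof -
    define a q where "a = i mod m" and "q = i div m"
    have i: "i = a + m * q" "a < m" using \<open>4 \<le> m\<close> by (simp_all add: a_def q_def)
    have 2: "2 \<le> card (s a \<inter> s (j mod m))" using that(3) by (simp add: a_def)
    show ?thesis
    proof (cases "j < m + m * q")
      case True
      define b where "b = j - m * q"
      have j: "j = b + m * q" "a < b" "b < m" using True i that(1) by (auto simp: b_def)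
      then have "j mod m = b" by simp
      then have "b = Suc a \<or> a = 0 \<and> b = m - 1" using far[of a b] 2 j by simp
      then show ?thesis using i j \<open>4 \<le> m\<close> by auto
    next
      case False
      define b where "b = j - (m + m * q)"
      have j: "j = b + m * Suc q" "b < a" using False i that(2) by (auto simp: b_def)
      moreover have "b < m" using j i by simp
      ultimately have "j mod m = b" by (simp only: mod_mult_self2 mod_less)
      then have "a = Suc b \<or> b = 0 \<and> a = m - 1" using far[of b a] 2 j i by (simp add: Int_commute)
      then show ?thesis using i j \<open>4 \<le> m\<close> by auto
    qed
  qed
  ultimately show "triangle_strip m (\<lambda>i. s (i mod m))"
    using assms(1) card by (simp add: triangle_strip_def)
  show "range (\<lambda>i. s (i mod m)) = s ` {..<m}"
  proof
    show "range (\<lambda>i. s (i mod m)) \<subseteq> s ` {..<m}" using \<open>4 \<le> m\<close> by auto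
    show "s ` {..<m} \<subseteq> range (\<lambda>i. s (i mod m))"
    proof
      fix y assume "y \<in> s ` {..<m}"
      then obtain i where "i < m" "y = s i" by auto
      then have "y = s (i mod m)" by simp
      then show "y \<in> range (\<lambda>i. s (i mod m))" by blast
    qed
  qed
qed

context
  fixes m :: nat and t :: "nat \<Rightarrow> 'a set"
  assumes strip: "triangle_strip m t"
begin

lemma strip_ge_4: "4 \<le> m" and strip_periodic: "t (i + m) = t i" and strip_card: "card (t i) = 3"
  and strip_step: "2 \<le> card (t i \<inter> t (Suc i))"
  using strip by (simp_all add: triangle_strip_def)

lemma strip_far_card:
  "\<lbrakk>i < j; j < i + m; 2 \<le> card (t i \<inter> t j)\<rbrakk> \<Longrightarrow> j = Suc i \<or> Suc j = i + m"
  using strip by (simp add: triangle_strip_def)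

lemma strip_finite: "finite (t i)"
  using strip_card[of i] by (simp add: card_ge_0_finite)

lemma strip_far:
  "\<lbrakk>i < j; j < i + m; a \<noteq> b; a \<in> t i; b \<in> t i; a \<in> t j; b \<in> t j\<rbrakk> \<Longrightarrow> j = Suc i \<or> Suc j = i + m"
  using strip_far_card card_inter_ge_2I[of a b "t i" "t j"] strip_finite by blast

lemma strip_periodic_mult: "t (i + m * k) = t i"
proof (induction k)
  case (Suc k)
  have "t (i + m * Suc k) = t ((i + m * k) + m)" by (simp add: algebra_simps)
  then show ?case using Suc strip_periodic by simp
qed simp

lemma strip_mod: "t (i mod m) = t i"
  using strip_periodic_mult[of "i mod m" "i div m"] by (simp add: add.commute)

lemma strip_rotate: "triangle_strip m (\<lambda>i. t (i + k))"
  unfolding triangle_strip_def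
proof (intro conjI allI impI)
  show "t (i + m + k) = t (i + k)" for i
    using strip_periodic[of "i + k"] by (simp add: ac_simps)
  show "j = Suc i \<or> Suc j = i + m"
    if "i < j \<and> j < i + m \<and> 2 \<le> card (t (i + k) \<inter> t (j + k))" for i j
    using strip_far_card[of "i + k" "j + k"] that by auto
  show "2 \<le> card (t (i + k) \<inter> t (Suc i + k))" for i using strip_step[of "i + k"] by simp
qed (simp_all add: strip_ge_4 strip_card)

lemma strip_index_from: "\<exists>i. k \<le> i \<and> i < k + m \<and> t j = t i"
proof -
  let ?i = "k + (j + m * k - k) mod m"
  have "0 < m" using strip_ge_4 by simp
  then have kj: "k \<le> j + m * k" by (cases m) auto
  let ?d = "j + m * k - k"
  have "t ?i = t (?i + m * (?d div m))" by (rule strip_periodic_mult[symmetric])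
  also have "?i + m * (?d div m) = j + m * k" using kj by (simp add: add.assoc)
  also have "t (j + m * k) = t j" by (rule strip_periodic_mult)
  finally have "t ?i = t j" .
  then show ?thesis using \<open>0 < m\<close> by (intro exI[of _ ?i]) auto
qed

lemma strip_range_from: "range t = t ` {k..<k + m}"
proof -
  have "t j \<in> t ` {k..<k + m}" for j
    using strip_index_from[of k j] by (metis atLeastLessThan_iff imageI)
  then show ?thesis by auto
qed

lemma strip_range_shift: "range (\<lambda>i. t (i + k)) = range t"
proof -
  have "range t \<subseteq> range (\<lambda>i. t (i + k))"
  proof
    fix y assume "y \<in> range t"
    then obtain i where "k \<le> i" "y = t i" using strip_index_from[of k] by blast
    then have "y = t (i - k + k)" by simp
    then show "y \<in> range (\<lambda>i. t (i + k))" by blast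
  qed
  then show ?thesis by auto
qed

lemma strip_neq:
  assumes "i < j" "j < i + m"
  shows "t i \<noteq> t j"
proof
  have no_step: "t k \<noteq> t (Suc k)" for k
  proof
    assume "t k = t (Suc k)"
    then have "2 \<le> card (t k \<inter> t (Suc (Suc k)))" using strip_step[of "Suc k"] by simp
    moreover have "Suc (Suc k) < k + m" using strip_ge_4 by simp
    ultimately have "Suc (Suc k) = Suc k \<or> Suc (Suc (Suc k)) = k + m"
      using strip_far_card[of k "Suc (Suc k)"] by simp
    then show False using strip_ge_4 by simp
  qed
  assume eq: "t i = t j"
  then have "2 \<le> card (t i \<inter> t j)" by (simp add: strip_card)
  then have "j = Suc i \<or> Suc j = i + m" using strip assms by (auto simp: triangle_strip_def)
  then show False
  proof
    assume "Suc j = i + m"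
    then have "t (Suc j) = t j" using eq strip_periodic by simp
    then show False using no_step[of j] by simp
  qed (use eq no_step in auto)
qed

lemma strip_inj: "inj_on t {..<m}"
proof (rule inj_onI)
  fix i j assume "i \<in> {..<m}" "j \<in> {..<m}" "t i = t j"
  then show "i = j"
    using strip_neq[of i j] strip_neq[of j i] by (cases i j rule: linorder_cases) auto
qed

lemma strip_range: "range t = t ` {..<m}"
  using strip_range_from[of 0] by (simp add: atLeast0LessThan)

lemma strip_card_range: "card (range t) = m" and strip_finite_range: "finite (range t)"
  unfolding strip_range using strip_inj by (simp_all add: card_image)

lemma strip_finite_Union: "finite (\<Union> (range t))"
  using strip_finite_range strip_finite by auto

lemma strip_edge:
  assumes "x \<in> t i" "x \<in> t (Suc i)"
  obtains y where "y \<noteq> x" "t i \<inter> t (Suc i) = {x, y}"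
proof -
  have "t i \<noteq> t (Suc i)" using strip_neq[of i "Suc i"] strip_ge_4 by simp
  then have "card (t i \<inter> t (Suc i)) \<noteq> 3"
    using strip_card[of i] strip_card[of "Suc i"] strip_finite
    by (metis card_subset_eq inf.cobounded1 inf.cobounded2)
  moreover have "card (t i \<inter> t (Suc i)) \<le> 3"
    using strip_card[of i] strip_finite by (metis card_mono inf.cobounded1)
  ultimately have "card (t i \<inter> t (Suc i)) = 2" using strip_step[of i] by linarith
  then obtain a b where "t i \<inter> t (Suc i) = {a, b}" "a \<noteq> b" by (auto simp: card_2_iff)
  moreover have "x = a \<or> x = b" using calculation assms by blast
  ultimately show thesis using that[of a] that[of b] by (metis insert_commute)
qed

lemma strip_triangle_eqI:
  assumes "distinct [a, b, c]" "a \<in> t i" "b \<in> t i" "c \<in> t i"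
  shows "t i = {a, b, c}"
proof -
  have "card {a, b, c} = card (t i)" using assms(1) strip_card by simp
  then show ?thesis using assms strip_finite[of i] card_subset_eq[of "t i" "{a, b, c}"] by auto
qed

lemma strip_triangle_third:
  assumes "a \<in> t i" "b \<in> t i" "a \<noteq> b"
  obtains c where "t i = {a, b, c}" "c \<noteq> a" "c \<noteq> b"
proof -
  have "card (t i - {a, b}) = 1" using assms strip_card strip_finite by (simp add: card_Diff_subset)
  then obtain c where "t i - {a, b} = {c}" by (auto simp: card_1_singleton_iff)
  then show thesis using that[of c] assms by blast
qed

text \<open>
  Any two edges of a triangle meet, in particular those shared with its two neighbours. The common
  vertex of three consecutive triangles is the apex of the middle one.
\<close>

lemma strip_apex:
  obtains x where "x \<in> t i" "x \<in> t (Suc i)" "x \<in> t (Suc (Suc i))"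
proof -
  obtain a b where ab: "a \<noteq> b" "a \<in> t i" "b \<in> t i" "a \<in> t (Suc i)" "b \<in> t (Suc i)"
    using strip_step[of i] strip_finite two_le_card_iff[of "t i \<inter> t (Suc i)"] by auto
  obtain c d where cd: "c \<noteq> d" "c \<in> t (Suc i)" "d \<in> t (Suc i)" "c \<in> t (Suc (Suc i))" "d \<in> t (Suc (Suc i))"
    using strip_step[of "Suc i"] strip_finite two_le_card_iff[of "t (Suc i) \<inter> t (Suc (Suc i))"] by auto
  obtain e where "t (Suc i) = {a, b, e}" using strip_triangle_third[OF ab(4,5,1)] by blast
  then have "c \<in> {a, b} \<or> d \<in> {a, b}" using cd by auto
  then show thesis using that ab cd by blast
qed

text \<open>
  Opposite triangles share at most one vertex here, and both ways around the strip lead through it.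
\<close>

lemma strip_common_if_4:
  assumes "m = 4"
  shows "\<exists>z. \<forall>i. z \<in> t i"
proof -
  obtain x where x: "x \<in> t 0" "x \<in> t 1" "x \<in> t 2" using strip_apex[of 0] by (auto simp: numeral_2_eq_2)
  obtain y where y: "y \<in> t 2" "y \<in> t 3" "y \<in> t 4"
    using strip_apex[of 2] by (auto simp: eval_nat_numeral)
  then have "y \<in> t 0" using strip_periodic[of 0] assms by simp
  then have "x = y" using strip_far[of 0 2 x y] x y assms by auto
  have "x \<in> t i" for i
  proof -
    have "i mod m < 4" using assms by simp
    then have "i mod m = 0 \<or> i mod m = 1 \<or> i mod m = 2 \<or> i mod m = 3" by linarith
    then show ?thesis using x y \<open>x = y\<close> strip_mod[of i] by metis
  qed
  then show ?thesis by blast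
qed

lemma leaves_between:
  assumes "a < b" "z \<in> t a" "z \<notin> t b"
  obtains d where "a \<le> d" "d < b" "z \<in> t d" "z \<notin> t (Suc d)"
proof -
  have "\<exists>d. a \<le> d \<and> d < b \<and> z \<in> t d \<and> z \<notin> t (Suc d)"
    using assms(1,3)
  proof (induction b)
    case (Suc b)
    show ?case
    proof (cases "z \<in> t b")
      case True
      then show ?thesis using Suc.prems by (intro exI[of _ b]) auto
    next
      case False
      then have "a \<noteq> b" using assms(2) by blast
      then show ?thesis using Suc False by (auto intro: less_SucI)
    qed
  qed simp
  then show thesis using that by blast
qed

lemma single_run_between:
  assumes "single_runs m t" "z \<in> t a" "z \<in> t b" "a \<le> k" "k \<le> b" "z \<notin> t c" "b \<le> c" "c \<le> a + m"
  shows "z \<in> t k"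
proof (rule ccontr)
  assume "z \<notin> t k"
  then have "a < k" using assms by (metis le_neq_implies_less)
  then obtain d where d: "a \<le> d" "d < k" "z \<in> t d" "z \<notin> t (Suc d)"
    using leaves_between assms(2) \<open>z \<notin> t k\<close> by metis
  have "b < c" using assms by (metis le_neq_implies_less)
  then obtain e where e: "b \<le> e" "e < c" "z \<in> t e" "z \<notin> t (Suc e)"
    using leaves_between assms by metis
  have "d < e" "e < d + m" using d e assms by auto
  then show False using assms(1) d e by (auto simp: single_runs_def)
qed

lemma fan_exists:
  assumes "x \<in> t 0" "x \<in> t 1" "x \<in> t 2" "x \<in> t 3"
  obtains u w v where "fan t u w v x"
proof -
  obtain u where u: "u \<noteq> x" "t 0 \<inter> t 1 = {x, u}" using strip_edge[of x 0] assms by auto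
  obtain w where w: "w \<noteq> x" "t 1 \<inter> t 2 = {x, w}" using strip_edge[of x 1] assms by (auto simp: numeral_2_eq_2)
  obtain v where v: "v \<noteq> x" "t 2 \<inter> t 3 = {x, v}"
    using strip_edge[of x 2] assms by (auto simp: eval_nat_numeral)
  have in_t: "u \<in> t 0" "u \<in> t 1" "w \<in> t 1" "w \<in> t 2" "v \<in> t 2" "v \<in> t 3" using u v w by auto
  have 02: "\<not> (y \<in> t 0 \<and> y \<in> t 2)" if "y \<noteq> x" for y
    using strip_far[of 0 2 x y] that assms strip_ge_4 by auto
  have 13: "\<not> (y \<in> t 1 \<and> y \<in> t 3)" if "y \<noteq> x" for y
    using strip_far[of 1 3 x y] that assms strip_ge_4 by auto
  have neq: "u \<noteq> w" "u \<noteq> v" "w \<noteq> v" using 02[OF u(1)] 13[OF v(1)] in_t by auto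
  then have "fan t u w v x"
    unfolding fan_def using in_t u(1) v(1) w(1) assms
      strip_triangle_eqI[of u w x 1] strip_triangle_eqI[of w v x 2] by auto
  then show thesis by (rule that)
qed

text \<open>
  If \<open>u\<close> and \<open>v\<close> lie in a common triangle, that triangle is outside the four triangles of the fan:
  otherwise \<open>ux\<close> or \<open>vx\<close> would lie in two triangles at distance \<open>2\<close>.
\<close>

lemma fan_chord_index:
  assumes fan: "fan t u w v x" and j: "{u, v} \<subseteq> t j"
  obtains k where "4 \<le> k" "k < m" "{u, v} \<subseteq> t k"
proof -
  obtain k where k: "k < m" "t j = t k" using strip_index_from[of 0 j] by auto
  have "k \<noteq> 0" using strip_far[of 0 2 v x] fan j k strip_ge_4 by (auto simp: fan_def)
  moreover have "k \<noteq> 1" "k \<noteq> 2" using fan j k by (auto simp: fan_def)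
  moreover have "k \<noteq> 3" using strip_far[of 1 3 u x] fan j k strip_ge_4 by (auto simp: fan_def)
  ultimately show thesis using that[of k] j k by auto
qed

text \<open>
  With single runs, \<open>v\<close> cannot be dropped between the fan and the triangle through \<open>uv\<close>, and \<open>u\<close>
  cannot be dropped on the way from there around the strip back to the fan.
\<close>

lemma fan_end_run:
  assumes fan: "fan t u w v x" and runs: "single_runs m t" and k: "4 \<le> k" "k < m" "{u, v} \<subseteq> t k"
  shows "2 \<le> i \<Longrightarrow> i \<le> k \<Longrightarrow> v \<in> t i" and "k \<le> i \<Longrightarrow> i \<le> m + 1 \<Longrightarrow> u \<in> t i"
proof -
  have "v \<notin> t (1 + m)" "v \<in> t 2" using fan strip_periodic[of 1] by (auto simp: fan_def)
  then show "2 \<le> i \<Longrightarrow> i \<le> k \<Longrightarrow> v \<in> t i"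
    using single_run_between[OF runs, of v 2 k i "1 + m"] k by auto
  have "u \<notin> t (2 + m)" "u \<in> t (1 + m)" using fan strip_periodic[of 1] strip_periodic[of 2]
    by (auto simp: fan_def)
  then show "k \<le> i \<Longrightarrow> i \<le> m + 1 \<Longrightarrow> u \<in> t i"
    using single_run_between[OF runs, of u k "1 + m" i "2 + m"] k by auto
qed

end

lemma single_runs_shift: "single_runs m t \<Longrightarrow> single_runs m (\<lambda>i. t (i + k))"
  by (auto simp: single_runs_def dest!: spec[of _ "_ + k"])

lemma unsplittableD:
  "unsplittable t \<Longrightarrow> fan (\<lambda>i. t (i + k)) u w v x \<Longrightarrow> \<exists>j. {u, v} \<subseteq> t j"
  unfolding unsplittable_def by blast

lemma unsplittable_shift:
  assumes "triangle_strip m t" "unsplittable t"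
  shows "unsplittable (\<lambda>i. t (i + k))"
  unfolding unsplittable_def
proof (intro allI impI)
  fix l u w v x assume "fan (\<lambda>i. t (i + l + k)) u w v x"
  then have "fan (\<lambda>i. t (i + (l + k))) u w v x" by (simp add: add.assoc)
  then have "\<exists>j. {u, v} \<subseteq> t j" using assms(2) unfolding unsplittable_def by blast
  then obtain j where "{u, v} \<subseteq> t j" ..
  moreover obtain i where "k \<le> i" "t j = t i" using strip_index_from[OF assms(1)] by blast
  ultimately show "\<exists>j. {u, v} \<subseteq> t (j + k)" by (metis le_add_diff_inverse2)
qed

text \<open>
  Let \<open>uv\<close> block the merger of the second and the third triangle. The run of \<open>v\<close> starts in the third
  triangle and has to reach a triangle through \<open>uv\<close>, so it covers the fifth one. Then the third and
  the fifth triangle share \<open>vx\<close> although they are not neighbours.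
\<close>

lemma no_five_run:
  assumes strip: "triangle_strip m t" and runs: "single_runs m t" and uns: "unsplittable t"
    and x: "x \<in> t k" "x \<in> t (k + 1)" "x \<in> t (k + 2)" "x \<in> t (k + 3)" "x \<in> t (k + 4)"
  shows False
proof -
  define s where "s i = t (i + k)" for i
  have s: "triangle_strip m s" "single_runs m s" "unsplittable s"
    unfolding s_def using strip_rotate[OF strip] single_runs_shift[OF runs]
      unsplittable_shift[OF strip uns] by auto
  have xs: "x \<in> s 0" "x \<in> s 1" "x \<in> s 2" "x \<in> s 3" "x \<in> s 4"
    using x by (simp_all add: s_def add.commute)
  obtain u w v where fan: "fan s u w v x" using fan_exists[OF s(1) xs(1-4)] by blast
  then obtain j where "{u, v} \<subseteq> s j"
    using unsplittableD[OF s(3), of 0 u w v x] by auto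
  then obtain j where j: "4 \<le> j" "j < m" "{u, v} \<subseteq> s j"
    using fan_chord_index[OF s(1) fan] by blast
  then have "v \<in> s 4" using fan_end_run(1)[OF s(1) fan s(2) j, of 4] by simp
  then show False using strip_far[OF s(1), of 2 4 v x] fan xs j by (auto simp: fan_def)
qed


subsection \<open>Strips that cannot be reduced\<close>

text \<open>
  The run of \<open>v\<close> extends from the fan forwards and the run of \<open>u\<close> backwards until they meet in a
  triangle through \<open>uv\<close>. As runs have at most four triangles, this leaves at most seven triangles.
  Let \<open>y\<close> be the third vertex of the triangle through \<open>uv\<close>. With five triangles, \<open>xy\<close> would lie in
  two triangles that are not neighbours; with seven, the run of \<open>v\<close> contains a fan whose chord \<open>xy\<close>
  is missing, so it could be contracted; six give the two exceptional graphs.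
\<close>

lemma irreducible_strip_with_fan:
  assumes strip: "triangle_strip m t" and runs: "single_runs m t" and uns: "unsplittable t"
    and fan: "fan t u w v x"
  shows "m = 6 \<and> (\<exists>u v w x z q. distinct [u, v, w, x, z, q] \<and>
    (range t = {{u, x, q}, {u, w, x}, {w, v, x}, {v, x, z}, {u, v, z}, {u, v, q}} \<or>
     range t = {{u, x, q}, {u, w, x}, {w, v, x}, {v, x, z}, {u, v, z}, {u, z, q}}))"
proof -
  note five = no_five_run[OF strip runs uns] and far = strip_far[OF strip]
  have "\<exists>j. {u, v} \<subseteq> t j"
    using unsplittableD[OF uns, of 0 u w v x] fan by simp
  then obtain j where j: "4 \<le> j" "j < m" "{u, v} \<subseteq> t j"
    using fan_chord_index[OF strip fan] by blast
  note v_run = fan_end_run(1)[OF strip fan runs j] and u_run = fan_end_run(2)[OF strip fan runs j]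
  have d: "u \<noteq> w" "u \<noteq> v" "u \<noteq> x" "w \<noteq> v" "w \<noteq> x" "v \<noteq> x"
    and t1: "t 1 = {u, w, x}" and t2: "t 2 = {w, v, x}" and in03: "u \<in> t 0" "x \<in> t 0" "v \<in> t 3" "x \<in> t 3"
    using fan by (auto simp: fan_def)
  have "j \<le> 5" using five[of v 2] v_run j by (cases "6 \<le> j") auto
  have "m \<le> j + 2"
  proof (rule ccontr)
    assume "\<not> m \<le> j + 2"
    then have "j \<le> m - 3" "m - 3 + 4 = m + 1" by auto
    then show False using five[of u "m - 3"] u_run by auto
  qed
  obtain q where t0: "t 0 = {u, x, q}" "q \<noteq> u" "q \<noteq> x"
    using strip_triangle_third[OF strip in03(1,2) d(3)] by blast
  obtain z where t3: "t 3 = {v, x, z}" "z \<noteq> v" "z \<noteq> x"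
    using strip_triangle_third[OF strip in03(3,4) d(6)] by blast
  have "v \<notin> t 0" using far[of 0 2 v x] t2 in03 d j by auto
  have "u \<notin> t 3" using far[of 1 3 u x] t1 in03 d j by auto
  have "w \<notin> t 0" "w \<notin> t 3"
    using far[of 0 2 w x] far[of 1 3 w x] t1 t2 in03 d j by auto
  then have wqz: "w \<noteq> q" "w \<noteq> z" "z \<noteq> u" "q \<noteq> v"
    using t0 t3 \<open>v \<notin> t 0\<close> \<open>u \<notin> t 3\<close> by auto
  have x4: "x \<notin> t 4" using five[of x 0, unfolded add_0] in03 t1 t2 by blast
  have t34: "z \<in> t 4"
  proof -
    have "v \<in> t (Suc 3)" using v_run[of 4] j by simp
    then obtain y where "y \<noteq> v" "t 3 \<inter> t (Suc 3) = {v, y}"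
      using strip_edge[OF strip in03(3)] by blast
    then have "y \<in> t 3" "y \<in> t 4" "y \<noteq> v" by auto
    then show ?thesis using t3(1) x4 by auto
  qed
  have per: "t m = t 0" "t (Suc m) = t 1" "t (Suc (Suc m)) = t 2" "t (m + 3) = t 3"
    using strip_periodic[OF strip, of 0] strip_periodic[OF strip, of 1] strip_periodic[OF strip, of 2]
      strip_periodic[OF strip, of 3] by (simp_all add: add.commute)
  have xl: "x \<notin> t (m - 1)"
  proof
    assume "x \<in> t (m - 1)"
    moreover have "m - 1 + 1 = m" "m - 1 + 2 = Suc m" "m - 1 + 3 = Suc (Suc m)" "m - 1 + 4 = m + 3"
      using j by auto
    ultimately show False using five[of x "m - 1"] per in03 t1 t2 by (simp add: add.commute)
  qed
  have uq: "q \<in> t (m - 1)"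
  proof -
    have "u \<in> t (m - 1)" "Suc (m - 1) = m" using u_run[of "m - 1"] j by auto
    then obtain y where "y \<noteq> u" "t (m - 1) \<inter> t m = {u, y}"
      using strip_edge[OF strip, of u "m - 1"] per(1) in03(1) by metis
    then have "y \<in> t (m - 1)" "y \<in> t 0" "y \<noteq> u" using per(1) by auto
    then show ?thesis using t0(1) xl by auto
  qed
  have uv: "u \<in> t j" "v \<in> t j" using j by auto
  have range6: "range t = {t 0, t 1, t 2, t 3, t 4, t 5}" if "m = 6"
    unfolding strip_range[OF strip] that by (simp add: lessThan_Suc eval_nat_numeral insert_commute)
  have concl1: ?thesis
    if "range t = {{u, x, q}, {u, w, x}, {w, v, x}, {v, x, z}, {u, v, z}, {u, v, q}}"
      and "distinct [u, v, w, x, z, q]" "m = 6" for u v w x z q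
    using that by blast
  have concl2: ?thesis
    if "range t = {{u, x, q}, {u, w, x}, {w, v, x}, {v, x, z}, {u, v, z}, {u, z, q}}"
      and "distinct [u, v, w, x, z, q]" "m = 6" for u v w x z q
    using that by blast
  consider "j = 4" "m = 5" | "j = 4" "m = 6" | "j = 5" "m = 6" | "j = 5" "m = 7"
    using j \<open>j \<le> 5\<close> \<open>m \<le> j + 2\<close> by linarith
  then show ?thesis
  proof cases
    case 1
    then have "t 4 = {u, v, z}" "q \<in> t 4"
      using strip_triangle_eqI[OF strip, of u v z 4] uv t34 d wqz t3 uq by auto
    then have "q = z" using t0 wqz by auto
    then show ?thesis using far[of 0 3 x z] t0 t3 1 by auto
  next
    case 2
    then have t4: "t 4 = {u, v, z}"
      using strip_triangle_eqI[OF strip, of u v z 4] uv t34 d wqz t3 by auto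
    have u5: "u \<in> t 5" "q \<in> t 5" using u_run[of 5] 2 uq by auto
    have "q \<noteq> z" using far[of 0 4 u z] t0 t4 wqz 2 by auto
    show ?thesis
    proof (cases "v \<in> t 5")
      case True
      then have "t 5 = {u, v, q}"
        using strip_triangle_eqI[OF strip, of u v q 5] u5 d wqz t0 by auto
      then have "range t = {{u, x, q}, {u, w, x}, {w, v, x}, {v, x, z}, {u, v, z}, {u, v, q}}"
        unfolding range6[OF 2(2)] t0(1) t1 t2 t3(1) t4 by simp
      then show ?thesis by (rule concl1) (use d wqz t0(2-) t3(2-) \<open>q \<noteq> z\<close> 2(2) in auto)
    next
      case False
      obtain y where "y \<noteq> u" "t 4 \<inter> t 5 = {u, y}" using strip_edge[OF strip, of u 4] uv u5 2 by auto
      then have "y \<in> t 4" "y \<in> t 5" "y \<noteq> u" by auto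
      then have "z \<in> t 5" using t4 False by auto
      then have "t 5 = {u, z, q}"
        using strip_triangle_eqI[OF strip, of u z q 5] u5 wqz t0 \<open>q \<noteq> z\<close> by auto
      then have "range t = {{u, x, q}, {u, w, x}, {w, v, x}, {v, x, z}, {u, v, z}, {u, z, q}}"
        unfolding range6[OF 2(2)] t0(1) t1 t2 t3(1) t4 by simp
      then show ?thesis by (rule concl2) (use d wqz t0(2-) t3(2-) \<open>q \<noteq> z\<close> 2(2) in auto)
    qed
  next
    case 3
    then have t5: "t 5 = {u, v, q}"
      using strip_triangle_eqI[OF strip, of u v q 5] uv uq d wqz t0 by auto
    have v4: "v \<in> t 4" using v_run[of 4] 3 by simp
    have "q \<noteq> z" using far[of 3 5 v z] t3 t5 wqz 3 by auto
    show ?thesis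
    proof (cases "u \<in> t 4")
      case True
      then have "t 4 = {u, v, z}"
        using strip_triangle_eqI[OF strip, of u v z 4] v4 t34 d wqz t3 by auto
      then have "range t = {{u, x, q}, {u, w, x}, {w, v, x}, {v, x, z}, {u, v, z}, {u, v, q}}"
        unfolding range6[OF 3(2)] t0(1) t1 t2 t3(1) t5 by simp
      then show ?thesis by (rule concl1) (use d wqz t0(2-) t3(2-) \<open>q \<noteq> z\<close> 3(2) in auto)
    next
      case False
      obtain y where "y \<noteq> v" "t 4 \<inter> t 5 = {v, y}" using strip_edge[OF strip, of v 4] uv v4 3 by auto
      then have "y \<in> t 4" "y \<in> t 5" "y \<noteq> v" by auto
      then have "q \<in> t 4" using t5 False by auto
      then have t4: "t 4 = {v, z, q}"
        using strip_triangle_eqI[OF strip, of v z q 4] v4 t34 wqz t3 \<open>q \<noteq> z\<close> by auto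
      \<comment> \<open>the mirror image of the previous graph: \<open>u\<close> and \<open>v\<close> as well as \<open>z\<close> and \<open>q\<close> change roles\<close>
      have "t 1 = {w, u, x}" "t 2 = {v, w, x}" "t 4 = {v, q, z}" "t 5 = {v, u, q}"
        using t1 t2 t4 t5 by (simp_all only: insert_commute)
      moreover have "range t = {t 3, t 2, t 1, t 0, t 5, t 4}" unfolding range6[OF 3(2)] by blast
      ultimately have "range t = {{v, x, z}, {v, w, x}, {w, u, x}, {u, x, q}, {v, u, q}, {v, q, z}}"
        using t0(1) t3(1) by simp
      then show ?thesis by (rule concl2) (use d wqz t0(2-) t3(2-) \<open>q \<noteq> z\<close> 3(2) in auto)
    qed
  next
    case 4
    have u56: "u \<in> t 5" "u \<in> t 6" "u \<in> t 7" "u \<in> t 8" using u_run 4 by auto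
    have v45: "v \<in> t 4" "v \<in> t 5" using v_run 4 by auto
    have "u \<notin> t 4" using five[of u 4] u56 by auto
    have "z \<notin> t 5" using far[of 3 5 v z] t3 v45 4 by auto
    obtain y where y: "y \<noteq> v" "t 4 \<inter> t 5 = {v, y}" using strip_edge[OF strip, of v 4] v45 by auto
    have y': "y \<in> t 4" "y \<in> t 5" "y \<noteq> u" "y \<noteq> z" using y \<open>u \<notin> t 4\<close> \<open>z \<notin> t 5\<close> by auto
    have t4: "t 4 = {z, y, v}"
      using strip_triangle_eqI[OF strip, of z y v 4] v45 t34 y y' t3 by auto
    have t5: "t 5 = {u, v, y}"
      using strip_triangle_eqI[OF strip, of u v y 5] v45 u56 y y' d by auto
    have "y \<noteq> x" using x4 y' by auto
    have "t 3 = {x, z, v}" using t3(1) by (simp add: insert_commute)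
    moreover have "distinct [x, z, y, v]" using t3(2,3) y(1) y'(4) \<open>y \<noteq> x\<close> d(6) by simp
    moreover have "0 + 2 = (2 :: nat)" "1 + 2 = (3 :: nat)" "2 + 2 = (4 :: nat)" "3 + 2 = (5 :: nat)"
      by simp_all
    ultimately have fan2: "fan (\<lambda>i. t (i + 2)) x z y v"
      unfolding fan_def by (simp only: t2 t4 t5) simp
    have "\<exists>l. {x, y} \<subseteq> t l" by (rule unsplittableD[OF uns fan2])
    then obtain l where "{x, y} \<subseteq> t l" ..
    then have l: "x \<in> t l" "y \<in> t l" by simp_all
    have "l mod m < m" using 4 by simp
    then obtain k where k: "k < 7" "x \<in> t k" "y \<in> t k"
      using l strip_mod[OF strip, of l] 4(2) that[of "l mod m"] by simp
    have "x \<notin> t 5" using far[of 1 5 u x] t1 u56 d 4 by auto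
    then have "k \<noteq> 4" "k \<noteq> 5" using x4 k(2) by metis+
    moreover have "k \<noteq> 6" using xl k(2) 4(2) by auto
    moreover have "y \<notin> t 0" using far[of 0 5 u y] in03 u56 y' 4 by auto
    then have "k \<noteq> 0" using k(3) by metis
    moreover have "y \<notin> t 1" using far[of 1 5 u y] t1 u56 y' 4 by auto
    then have "k \<noteq> 1" using k(3) by metis
    moreover have "y \<notin> t 2" using far[of 2 5 v y] t2 v45 y(1) y' 4 by auto
    then have "k \<noteq> 2" using k(3) by metis
    moreover have "y \<notin> t 3" using far[of 3 5 v y] in03 v45 y(1) y' 4 by auto
    then have "k \<noteq> 3" using k(3) by metis
    ultimately show ?thesis using k(1) by linarith
  qed
qed

text \<open>
  Without fans, consecutive apexes differ, so that every triangle consists of its own apex and those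
  of its two neighbours. The apexes \<open>X i\<close> are the vertices of a \<open>C\<^sub>m\<^sup>2\<close>; they are distinct because
  the run of \<open>X i\<close> ends after its third triangle.
\<close>

lemma strip_without_fan:
  assumes strip: "triangle_strip m t" and runs: "single_runs m t"
    and no_fan: "\<And>z i. \<not> (z \<in> t i \<and> z \<in> t (i + 1) \<and> z \<in> t (i + 2) \<and> z \<in> t (i + 3))"
  obtains X where "inj_on X {..<m}"
    and "range t = (\<lambda>i. {X i, X (Suc i mod m), X (Suc (Suc i mod m) mod m)}) ` {..<m}"
proof -
  define X where "X i = (SOME x. x \<in> t i \<and> x \<in> t (i + 1) \<and> x \<in> t (i + 2))" for i
  have X: "X i \<in> t i" "X i \<in> t (i + 1)" "X i \<in> t (i + 2)" for i
  proof -
    have "\<exists>x. x \<in> t i \<and> x \<in> t (i + 1) \<and> x \<in> t (i + 2)"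
      using strip_apex[OF strip, of i] by (metis Suc_eq_plus1 add_2_eq_Suc')
    from someI_ex[OF this] show "X i \<in> t i" "X i \<in> t (i + 1)" "X i \<in> t (i + 2)"
      by (auto simp: X_def)
  qed
  have X_mod: "X (i mod m) = X i" for i
  proof -
    have "t (i mod m + k) = t (i + k)" for k
      using strip_mod[OF strip] by (metis mod_add_left_eq)
    then show ?thesis unfolding X_def by (simp only: strip_mod[OF strip])
  qed
  have X3: "X i \<notin> t (i + 3)" for i using X no_fan by blast
  have t: "t (i + 2) = {X i, X (i + 1), X (i + 2)}" for i
  proof (rule strip_triangle_eqI[OF strip])
    show "distinct [X i, X (i + 1), X (i + 2)]"
      using X3[of i] X3[of "i + 1"] X[of "i + 1"] X[of "i + 2"] by (auto simp: eval_nat_numeral)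
    show "X i \<in> t (i + 2)" "X (i + 1) \<in> t (i + 2)" "X (i + 2) \<in> t (i + 2)"
      using X(3)[of i] X(2)[of "i + 1"] X(1)[of "i + 2"] by simp_all
  qed
  have "i = j" if "X i = X j" "i < m" "j < m" for i j
    using that
  proof (induction i j rule: linorder_wlog)
    case (le i j)
    show ?case
    proof (rule ccontr)
      assume "i \<noteq> j"
      then have "i + 2 < j + 2" "j + 2 < i + 2 + m" using le by auto
      moreover have "X i \<in> t (i + 2)" "X i \<notin> t (Suc (i + 2))" "X i \<in> t (j + 2)" "X i \<notin> t (Suc (j + 2))"
        using X(3)[of i] X(3)[of j] X3[of i] X3[of j] le(2) by (simp_all add: eval_nat_numeral)
      ultimately show False using runs unfolding single_runs_def by blast
    qed
  qed auto
  then have "inj_on X {..<m}" by (auto intro!: inj_onI)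
  moreover have "range t = (\<lambda>i. t (i + 2)) ` {..<m}"
    using strip_range[OF strip_rotate[OF strip, of 2]] strip_range_shift[OF strip, of 2] by simp
  moreover have "t (i + 2) = {X i, X (Suc i mod m), X (Suc (Suc i mod m) mod m)}" for i
    using t[of i] X_mod[of "Suc i"] X_mod[of "Suc (Suc i)"] by (simp add: mod_Suc_eq)
  ultimately show thesis using that[of X] by simp
qed

section \<open>Every strip is weakly derived\<close>

text \<open>
  A graph that is covered by its cycle-triangles is recovered from them. For such graphs the weak
  operations become operations on sets of triangles.
\<close>

definition triangle_union :: "'a set set \<Rightarrow> 'a pair_pre_digraph" where
  "triangle_union S = \<lparr> pverts = \<Union> S, parcs = {(a, b). a \<noteq> b \<and> (\<exists>t\<in>S. a \<in> t \<and> b \<in> t)} \<rparr>"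

lemma triangle_union_simps:
  "pverts (triangle_union S) = \<Union> S"
  "(a, b) \<in> parcs (triangle_union S) \<longleftrightarrow> a \<noteq> b \<and> (\<exists>t\<in>S. a \<in> t \<and> b \<in> t)"
  by (simp_all add: triangle_union_def)

lemma triangle_union_wf: "parcs (triangle_union S) \<subseteq> pverts (triangle_union S) \<times> pverts (triangle_union S)"
  by (auto simp: triangle_union_def)

lemma triangles_triangle_union: "t \<in> S \<Longrightarrow> card t = 3 \<Longrightarrow> t \<in> triangles (triangle_union S)"
  by (auto simp: triangles_def triangle_union_simps)

lemma strip_image:
  assumes strip: "triangle_strip m t" and f: "inj_on f (\<Union> (range t))"
  shows "triangle_strip m (\<lambda>i. f ` t i)"
proof -
  have "f ` t i \<inter> f ` t j = f ` (t i \<inter> t j)" for i j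
    using f by (intro inj_on_image_Int[symmetric, of f "\<Union> (range t)"]) auto
  moreover have "card (f ` A) = card A" if "A \<subseteq> t i" for A i
    using that f by (intro card_image inj_on_subset[OF f]) auto
  ultimately show ?thesis
    using strip unfolding triangle_strip_def by (metis inf.cobounded1 order_refl)
qed

lemma strip_induced_cycle:
  assumes strip: "triangle_strip m t"
  shows "induced_cycle (triangle_graph (triangle_union (range t))) (range t)"
proof (rule induced_cycleI[of t m])
  note m = strip_ge_4[OF strip]
  show "inj_on t {..<m}" "t ` {..<m} = range t" using strip_inj[OF strip] strip_range[OF strip] by auto
  show "3 \<le> m" using m by simp
  have tri: "t i \<in> triangles (triangle_union (range t))" for i
    using strip_card[OF strip] by (intro triangles_triangle_union) auto
  then show "range t \<subseteq> pverts (triangle_graph (triangle_union (range t)))"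
    by (auto simp: pverts_triangle_graph)
  have succ: "t (Suc i mod m) = t (Suc i)" for i by (rule strip_mod[OF strip])
  have fwd: "j = Suc i mod m \<or> i = Suc j mod m" if "i < j" "j < m" "2 \<le> card (t i \<inter> t j)" for i j
    using strip_far_card[OF strip, of i j] that by auto
  fix i j assume ij: "i < m" "j < m"
  have "t i \<noteq> t j \<longleftrightarrow> i \<noteq> j" using strip_inj[OF strip] ij by (auto dest: inj_onD)
  moreover have "2 \<le> card (t i \<inter> t j) \<longleftrightarrow> j = Suc i mod m \<or> i = Suc j mod m" if "i \<noteq> j"
  proof
    assume "2 \<le> card (t i \<inter> t j)"
    then show "j = Suc i mod m \<or> i = Suc j mod m"
      using fwd[of i j] fwd[of j i] that ij by (cases "i < j") (auto simp: Int_commute)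
  next
    assume "j = Suc i mod m \<or> i = Suc j mod m"
    then show "2 \<le> card (t i \<inter> t j)"
      using strip_step[OF strip, of i] strip_step[OF strip, of j] succ by (metis Int_commute)
  qed
  moreover have "i \<noteq> Suc i mod m" using m ij by (auto simp: Suc_mod_eq)
  ultimately show "(t i, t j) \<in> parcs (triangle_graph (triangle_union (range t))) \<longleftrightarrow>
      j = Suc i mod m \<or> i = Suc j mod m"
    using tri by (auto simp: parcs_triangle_graph)
qed

lemma strip_specified_cycle:
  assumes "triangle_strip m t"
  shows "specified_cycle (triangle_union (range t)) (range t)"
  using strip_induced_cycle[OF assms] strip_card_range[OF assms] strip_ge_4[OF assms]
  by (simp add: specified_cycle_def)

text \<open>
  Weakly derived graphs have prescribed vertex names, so derivability of an arbitrary set of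
  triangles is meant up to renaming.
\<close>

definition derivable :: "'a set set \<Rightarrow> bool" where
  "derivable S \<longleftrightarrow> (\<exists>f :: 'a \<Rightarrow> nat. inj_on f (\<Union> S) \<and>
     weakly_derived (triangle_union ((`) f ` S)) ((`) f ` S))"

lemma triangle_union_split:
  assumes "{u, v, x} \<in> S" "distinct [u, v, x, w]" "w \<notin> \<Union> S"
    and priv: "\<And>t. t \<in> S \<Longrightarrow> {u, v} \<subseteq> t \<Longrightarrow> t = {u, v, x}"
  shows "triangle_union (S - {{u, v, x}} \<union> {{u, w, x}, {w, v, x}}) =
    split_edge (triangle_union S) u v x w"
proof -
  let ?S = "S - {{u, v, x}} \<union> {{u, w, x}, {w, v, x}}"
  let ?H = "split_edge (triangle_union S) u v x w"
  have "\<Union> ?S = insert w (\<Union> S)"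
  proof -
    have "S = insert {u, v, x} (S - {{u, v, x}})" using assms(1) by blast
    then have "\<Union> S = {u, v, x} \<union> \<Union> (S - {{u, v, x}})" by (metis Union_insert)
    then show ?thesis by auto
  qed
  then have verts: "pverts (triangle_union ?S) = pverts ?H"
    by (simp add: triangle_union_def split_edge_def)
  have in_tri: "(a, b) \<in> parcs (triangle_union S)" if "a \<in> {u, v, x}" "b \<in> {u, v, x}" "a \<noteq> b" for a b
    unfolding triangle_union_simps using that assms(1)
    by (intro conjI bexI[of _ "{u, v, x}"])
  have in_new: "(a, b) \<in> parcs (triangle_union ?S)" if "a \<noteq> b" "{a, b} \<subseteq> t" "t \<in> ?S" for a b t
    unfolding triangle_union_simps using that by (intro conjI bexI[of _ t]) simp_all
  have "(a, b) \<in> parcs (triangle_union ?S) \<longleftrightarrow> (a, b) \<in> parcs ?H" for a b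
  proof
    assume "(a, b) \<in> parcs (triangle_union ?S)"
    then obtain t where ab: "a \<noteq> b" "t \<in> ?S" "a \<in> t" "b \<in> t" by (auto simp: triangle_union_simps)
    consider "t \<in> S" "t \<noteq> {u, v, x}" | "t = {u, w, x}" | "t = {w, v, x}" using ab(2) by blast
    then show "(a, b) \<in> parcs ?H"
    proof cases
      case 1
      then have "\<not> {u, v} \<subseteq> t" using priv by blast
      then have "(a, b) \<notin> {(u, v), (v, u)}" using ab(3,4) by auto
      moreover have "(a, b) \<in> parcs (triangle_union S)"
        using 1(1) ab(1,3,4) unfolding triangle_union_simps by blast
      ultimately show ?thesis unfolding split_edge_def by simp
    next
      case 2
      then have "(a, b) \<in> {(u, w), (w, u), (w, x), (x, w)} \<or> (a, b) \<in> {(u, x), (x, u)}"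
        using ab(1,3,4) by auto
      moreover have "{(u, x), (x, u)} \<subseteq> parcs (triangle_union S) - {(u, v), (v, u)}"
        using in_tri[of u x] in_tri[of x u] assms(2) by auto
      ultimately show ?thesis unfolding split_edge_def by (elim disjE) auto
    next
      case 3
      then have "(a, b) \<in> {(v, w), (w, v), (w, x), (x, w)} \<or> (a, b) \<in> {(v, x), (x, v)}"
        using ab(1,3,4) by auto
      moreover have "{(v, x), (x, v)} \<subseteq> parcs (triangle_union S) - {(u, v), (v, u)}"
        using in_tri[of v x] in_tri[of x v] assms(2) by auto
      ultimately show ?thesis unfolding split_edge_def by (elim disjE) auto
    qed
  next
    assume "(a, b) \<in> parcs ?H"
    then consider "(a, b) \<in> parcs (triangle_union S)" "(a, b) \<noteq> (u, v)" "(a, b) \<noteq> (v, u)"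
      | "(a, b) \<in> {(u, w), (w, u), (w, x), (x, w)}" | "(a, b) \<in> {(w, v), (v, w)}"
      by (auto simp: split_edge_def)
    then show "(a, b) \<in> parcs (triangle_union ?S)"
    proof cases
      case 1
      then obtain t where t: "a \<noteq> b" "t \<in> S" "a \<in> t" "b \<in> t" by (auto simp: triangle_union_simps)
      show ?thesis
      proof (cases "t = {u, v, x}")
        case True
        then have "{a, b} \<subseteq> {u, w, x} \<or> {a, b} \<subseteq> {w, v, x}" using t(3,4) 1(2,3) t(1) by auto
        then show ?thesis using in_new[OF t(1), of "{u, w, x}"] in_new[OF t(1), of "{w, v, x}"] by blast
      next
        case False
        then show ?thesis using in_new[OF t(1), of t] t by blast
      qed
    next
      case 2
      then have "a \<noteq> b" "{a, b} \<subseteq> {u, w, x}" using assms(2) by auto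
      then show ?thesis using in_new[of a b "{u, w, x}"] by blast
    next
      case 3
      then have "a \<noteq> b" "{a, b} \<subseteq> {w, v, x}" using assms(2) by auto
      then show ?thesis using in_new[of a b "{w, v, x}"] by blast
    qed
  qed
  then have "parcs (triangle_union ?S) = parcs ?H" by auto
  with verts show ?thesis by simp
qed

text \<open>
  Only the new vertex \<open>w\<close> needs a name among the natural numbers that is not yet in use; the other
  vertices keep theirs.
\<close>

lemma derivable_split:
  assumes strip: "triangle_strip m s" and S: "range s = S" and uvx: "{u, v, x} \<in> S" and
    d: "distinct [u, v, x, w]" "w \<notin> \<Union> S"
    and priv: "\<And>t. t \<in> S \<Longrightarrow> {u, v} \<subseteq> t \<Longrightarrow> t = {u, v, x}"
    and der: "derivable S"
  shows "derivable (S - {{u, v, x}} \<union> {{u, w, x}, {w, v, x}})"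
proof -
  from der obtain f :: "'a \<Rightarrow> nat" where f: "inj_on f (\<Union> S)"
    and wd: "weakly_derived (triangle_union ((`) f ` S)) ((`) f ` S)"
    by (auto simp: derivable_def)
  let ?T = "(`) f ` S"
  obtain w' where w': "w' \<notin> f ` \<Union> S"
    using strip_finite_Union[OF strip] S ex_new_if_finite[OF infinite_UNIV_nat] by blast
  define g where "g = f(w := w')"
  have gf: "g y = f y" if "y \<in> \<Union> S" for y using d(2) that by (auto simp: g_def)
  have uvx_in: "u \<in> \<Union> S" "v \<in> \<Union> S" "x \<in> \<Union> S" using uvx by blast+
  have inj: "f a = f b \<longleftrightarrow> a = b" if "a \<in> \<Union> S" "b \<in> \<Union> S" for a b
    using f that by (auto dest: inj_onD)
  have "f ` {u, v, x} \<in> ?T" using uvx by (rule imageI)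
  then have fuvx: "{f u, f v, f x} \<in> ?T" by simp
  have fpriv: "t = {f u, f v, f x}" if "t \<in> ?T" "{f u, f v} \<subseteq> t" for t
  proof -
    obtain t' where t': "t' \<in> S" "t = f ` t'" using \<open>t \<in> ?T\<close> by auto
    then have "u \<in> t'" "v \<in> t'" using that(2) inj uvx_in by (auto simp: image_iff)
    then show ?thesis using priv[of t'] t' by simp
  qed
  have sp: "specified_cycle (triangle_union ?T) ?T"
    using strip_specified_cycle[OF strip_image[OF strip]] f S by (auto simp: image_image)
  have fw: "w' \<notin> \<Union> ?T" using w' by auto
  have dist: "distinct [f u, f v, f x, w']" using d(1) uvx_in inj w' by auto
  have "private_edge ?T {f u, f v}"
    unfolding private_edge_def triangle_edges_def using fuvx fpriv dist by (auto intro!: ex1I[of _ "{f u, f v, f x}"])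
  then have "weakly_derived (split_edge (triangle_union ?T) (f u) (f v) (f x) w')
      (?T - {{f u, f v, f x}} \<union> {{f u, w', f x}, {w', f v, f x}})"
    using wd sp fuvx dist fw by (intro weakly_derived.split) (auto simp: triangle_union_simps)
  also have "split_edge (triangle_union ?T) (f u) (f v) (f x) w' =
      triangle_union (?T - {{f u, f v, f x}} \<union> {{f u, w', f x}, {w', f v, f x}})"
    using triangle_union_split[OF fuvx dist fw fpriv] by simp
  also have "?T - {{f u, f v, f x}} \<union> {{f u, w', f x}, {w', f v, f x}} =
      (`) g ` (S - {{u, v, x}} \<union> {{u, w, x}, {w, v, x}})"
  proof -
    have gim: "g ` t = f ` t" if "t \<in> S" for t
      using gf that by (intro image_cong) auto
    have "?T - {{f u, f v, f x}} = (`) f ` (S - {{u, v, x}})"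
    proof -
      have "inj_on ((`) f) S" using f by (intro inj_on_subset[OF inj_on_image_Pow]) auto
      from inj_on_image_set_diff[OF this, of S "{{u, v, x}}"] uvx show ?thesis by auto
    qed
    also have "\<dots> = (`) g ` (S - {{u, v, x}})" by (rule image_cong) (simp_all add: gim)
    finally have "?T - {{f u, f v, f x}} = (`) g ` (S - {{u, v, x}})" .
    moreover have "g u = f u" "g v = f v" "g x = f x" "g w = w'"
      using gf uvx_in by (auto simp: g_def)
    ultimately show ?thesis by (simp add: image_Un)
  qed
  finally have wd': "weakly_derived (triangle_union ((`) g ` (S - {{u, v, x}} \<union> {{u, w, x}, {w, v, x}})))
      ((`) g ` (S - {{u, v, x}} \<union> {{u, w, x}, {w, v, x}}))" .
  have "inj_on g (insert w (\<Union> S))"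
    using f w' d(2) unfolding g_def by (auto simp: inj_on_def)
  moreover have "\<Union> (S - {{u, v, x}} \<union> {{u, w, x}, {w, v, x}}) \<subseteq> insert w (\<Union> S)"
    using uvx_in by auto
  ultimately have "inj_on g (\<Union> (S - {{u, v, x}} \<union> {{u, w, x}, {w, v, x}}))"
    by (rule inj_on_subset)
  then show ?thesis using wd' unfolding derivable_def by blast
qed

lemma triangle_union_stick:
  assumes "u \<noteq> v" "u \<in> \<Union> S" "v \<in> \<Union> S" "w \<notin> \<Union> S"
    and sep: "\<And>t. t \<in> S \<Longrightarrow> \<not> (u \<in> t \<and> v \<in> t)"
  shows "triangle_union ((`) (\<lambda>z. if z = u \<or> z = v then w else z) ` S) =
    stick_vertices (triangle_union S) u v w"
proof -
  let ?f = "\<lambda>z. if z = u \<or> z = v then w else z"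
  let ?T = "(`) ?f ` S" and ?H = "stick_vertices (triangle_union S) u v w"
  have "\<Union> ?T = ?f ` \<Union> S" by auto
  also have "\<dots> = insert w (\<Union> S - {u, v})" using assms(2,3) by (auto simp: image_iff)
  finally have verts: "pverts (triangle_union ?T) = pverts ?H"
    by (simp add: triangle_union_simps stick_vertices_def Let_def)
  have "(a, b) \<in> parcs (triangle_union ?T) \<longleftrightarrow> (a, b) \<in> parcs ?H" for a b
  proof
    assume "(a, b) \<in> parcs (triangle_union ?T)"
    then obtain t a' b' where t: "t \<in> S" "a' \<in> t" "b' \<in> t" "a = ?f a'" "b = ?f b'" "a \<noteq> b"
      by (auto simp: triangle_union_simps)
    have "(a', b') \<in> parcs (triangle_union S)" "(b', a') \<in> parcs (triangle_union S)"
      using t by (auto simp: triangle_union_simps)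
    then show "(a, b) \<in> parcs ?H" using t(4-6)
      by (cases "a' = u \<or> a' = v"; cases "b' = u \<or> b' = v") (auto simp: stick_vertices_def Let_def)
  next
    assume "(a, b) \<in> parcs ?H"
    then obtain a' b' where ab: "(a', b') \<in> parcs (triangle_union S)" "a = ?f a'" "b = ?f b'"
    proof -
      let ?N = "parcs (triangle_union S) `` {u} \<union> parcs (triangle_union S) `` {v}"
      consider "(a, b) \<in> parcs (triangle_union S)" "a \<notin> {u, v}" "b \<notin> {u, v}"
        | "a = w" "b \<in> ?N" | "b = w" "a \<in> ?N"
        using \<open>(a, b) \<in> parcs ?H\<close> by (auto simp: stick_vertices_def Let_def)
      then show thesis
      proof cases
        case 1
        then show ?thesis using that[of a b] by auto
      next
        case 2
        then obtain y where y: "y \<in> {u, v}" "(y, b) \<in> parcs (triangle_union S)" by auto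
        then have "b \<notin> {u, v}" using sep by (auto simp: triangle_union_simps)
        then show ?thesis using that[of y b] y 2 by auto
      next
        case 3
        then obtain y where y: "y \<in> {u, v}" "(y, a) \<in> parcs (triangle_union S)" by auto
        then have "a \<notin> {u, v}" "(a, y) \<in> parcs (triangle_union S)"
          using sep by (auto simp: triangle_union_simps)
        then show ?thesis using that[of a y] y 3 by auto
      qed
    qed
    then obtain t where t: "t \<in> S" "a' \<in> t" "b' \<in> t" "a' \<noteq> b'" by (auto simp: triangle_union_simps)
    then have "?f a' \<noteq> ?f b'" using sep[of t] assms(4) by auto
    then show "(a, b) \<in> parcs (triangle_union ?T)"
      using t ab unfolding triangle_union_simps by blast
  qed
  then have "parcs (triangle_union ?T) = parcs ?H" by auto
  with verts show ?thesis by simp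
qed

text \<open>
  The merged vertex keeps the name \<open>z\<close> here, whereas sticking introduces a fresh vertex. The renaming
  absorbs the difference.
\<close>

lemma derivable_stick:
  fixes S :: "'a set set"
  assumes strip: "triangle_strip m s" and S: "range s = S"
    and zz: "z \<noteq> z'" "z \<in> \<Union> S" "z' \<in> \<Union> S"
    and sep: "\<And>t. t \<in> S \<Longrightarrow> \<not> (z \<in> t \<and> z' \<in> t)"
    and far: "\<And>t t' c. t \<in> S \<Longrightarrow> t' \<in> S \<Longrightarrow> z \<in> t \<Longrightarrow> c \<in> t \<Longrightarrow> z' \<in> t' \<Longrightarrow> c \<notin> t'"
    and der: "derivable S"
  shows "derivable ((`) (\<lambda>y. if y = z' then z else y) ` S)"
proof -
  from der obtain f :: "'a \<Rightarrow> nat" where f: "inj_on f (\<Union> S)"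
    and wd: "weakly_derived (triangle_union ((`) f ` S)) ((`) f ` S)"
    by (auto simp: derivable_def)
  let ?T = "(`) f ` S" and ?h = "\<lambda>y. if y = z' then z else y"
  obtain w where w: "w \<notin> f ` \<Union> S"
    using strip_finite_Union[OF strip] S ex_new_if_finite[OF infinite_UNIV_nat] by blast
  define g where "g = f(z := w)"
  let ?k = "\<lambda>y. if y = f z \<or> y = f z' then w else y"
  have inj: "f a = f b \<longleftrightarrow> a = b" if "a \<in> \<Union> S" "b \<in> \<Union> S" for a b
    using f that by (auto dest: inj_onD)
  have UT: "\<Union> ?T = f ` \<Union> S" by auto
  have in_T: "f z \<in> \<Union> ?T" "f z' \<in> \<Union> ?T" "f z \<noteq> f z'" using zz inj UT by auto
  have fsep: "\<not> (f z \<in> t \<and> f z' \<in> t)" if "t \<in> ?T" for t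
  proof -
    obtain t' where t': "t' \<in> S" "t = f ` t'" using \<open>t \<in> ?T\<close> by auto
    have "y \<in> t'" if "f y \<in> t" "y \<in> \<Union> S" for y
      using that t' inj by auto
    then show ?thesis using sep[OF t'(1)] zz by blast
  qed
  have ffar: False if st: "t \<in> ?T" "t' \<in> ?T" "f z \<in> t" "c \<in> t" "f z' \<in> t'" "c \<in> t'" for t t' c
  proof -
    obtain s s' where s: "s \<in> S" "t = f ` s" "s' \<in> S" "t' = f ` s'" using st(1,2) by blast
    have mem: "y \<in> s'' \<longleftrightarrow> f y \<in> f ` s''" if "y \<in> \<Union> S" "s'' \<in> S" for y s''
      using that inj by (auto simp: image_iff)
    obtain c' where "c' \<in> s" "c = f c'" using st(4) s(2) by blast
    then show False using far[of s s' c'] mem[of _ s] mem[of _ s'] s st zz by blast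
  qed
  have sp: "specified_cycle (triangle_union ?T) ?T"
    using strip_specified_cycle[OF strip_image[OF strip]] f S by (auto simp: image_image)
  have "3 \<le> graph_dist (triangle_union ?T) (f z) (f z')"
  proof -
    have "(f z, f z') \<notin> parcs (triangle_union ?T)"
      unfolding triangle_union_simps using fsep by blast
    moreover have "\<nexists>c. (f z, c) \<in> parcs (triangle_union ?T) \<and> (c, f z') \<in> parcs (triangle_union ?T)"
      unfolding triangle_union_simps using ffar by blast
    moreover have "f z \<in> pverts (triangle_union ?T)"
      unfolding triangle_union_simps by (rule in_T(1))
    ultimately show ?thesis
      using graph_dist_ge_3_iff[OF triangle_union_wf, of "f z" ?T "f z'"] in_T(3) by blast
  qed
  moreover have wT: "w \<notin> \<Union> ?T" using w UT by simp
  ultimately have "weakly_derived (stick_vertices (triangle_union ?T) (f z) (f z') w) ((`) ?k ` ?T)"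
    using wd sp in_T by (intro weakly_derived.stick) (simp_all add: triangle_union_simps)
  also have "stick_vertices (triangle_union ?T) (f z) (f z') w = triangle_union ((`) ?k ` ?T)"
    using triangle_union_stick[OF in_T(3,1,2) wT fsep] by simp
  also have "(`) ?k ` ?T = (`) g ` (`) ?h ` S"
  proof -
    have kg: "?k (f y) = g (?h y)" if "y \<in> \<Union> S" for y
      using that zz inj by (auto simp: g_def)
    have "?k ` f ` t = g ` ?h ` t" if "t \<in> S" for t
      unfolding image_image using kg that by (intro image_cong) blast+
    then show ?thesis unfolding image_image[of "(`) _"] by (intro image_cong) auto
  qed
  finally have "weakly_derived (triangle_union ((`) g ` (`) ?h ` S)) ((`) g ` (`) ?h ` S)" .
  moreover have "inj_on g (\<Union> S)" using f w zz(2) unfolding g_def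
    by (auto simp: inj_on_def)
  then have "inj_on g (\<Union> ((`) ?h ` S))"
    by (rule inj_on_subset) (use zz in auto)
  ultimately show ?thesis unfolding derivable_def by blast
qed

subsection \<open>Undoing the operations\<close>

text \<open>
  Cut the run structure of \<open>z\<close> at two positions where \<open>z\<close> is dropped and rename \<open>z\<close> to \<open>z'\<close> between
  them. Shared edges survive, because no edge shared across a cut contains \<open>z\<close>. A common neighbour
  \<open>c\<close> of \<open>z\<close> and \<open>z'\<close> would put \<open>zc\<close> into one triangle on each side of a cut; such triangles would be
  neighbours at the cut, but \<open>z\<close> is missing just after it. So \<open>z\<close> and \<open>z'\<close> are at distance at least
  \<open>3\<close>, and sticking them recovers the strip.
\<close>

lemma separate_runs:
  assumes strip: "triangle_strip m t" and runs: "\<not> single_runs m t" and z': "z' \<notin> \<Union> (range t)"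
  obtains s z where "triangle_strip m s" "range t = (`) (\<lambda>y. if y = z' then z else y) ` range s"
    and "z \<noteq> z'" "z \<in> \<Union> (range t)" "\<Union> (range s) = insert z' (\<Union> (range t))"
    and "\<And>k. \<not> (z \<in> s k \<and> z' \<in> s k)"
    and "\<And>k l c. z \<in> s k \<Longrightarrow> c \<in> s k \<Longrightarrow> z' \<in> s l \<Longrightarrow> c \<notin> s l"
proof -
  note m = strip_ge_4[OF strip]
  obtain z i j where ij: "i < j" "j < i + m"
    "z \<in> t i" "z \<notin> t (Suc i)" "z \<in> t j" "z \<notin> t (Suc j)"
    using runs unfolding single_runs_def by blast
  define r where "r k = t (k + Suc i)" for k
  define e where "e = j - Suc i"
  have r: "triangle_strip m r" "range r = range t"
    unfolding r_def using strip_rotate[OF strip, of "Suc i"] strip_range_shift[OF strip, of "Suc i"] by auto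
  have "j \<noteq> Suc i" using ij by auto
  then have e: "z \<notin> r 0" "z \<in> r e" "z \<notin> r (Suc e)" "z \<in> r (m - 1)" "e < m - 1"
    using ij strip_periodic[OF strip, of i] by (auto simp: r_def e_def add.commute)
  \<comment> \<open>\<open>r\<close> starts right after the first cut, and the second cut is after position \<open>e\<close>\<close>
  have z: "z \<noteq> z'" "z \<in> \<Union> (range t)" using z' ij(3) by auto
  have z'_r: "z' \<notin> r k" for k using z' r(2) by blast
  let ?h = "\<lambda>y. if y = z' then z else y" and ?f = "\<lambda>y. if y = z then z' else y"
  define s0 where "s0 k = (if k \<le> e then ?f ` r k else r k)" for k
  have h_s0: "?h ` s0 k = r k" for k
  proof -
    have hf: "?h (?f y) = y" "?h y = y" if "y \<in> r k" for y using that z'_r[of k] by auto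
    have "?h ` ?f ` r k = r k"
      unfolding image_image by (rule trans[OF image_cong[OF refl hf(1)] image_ident])
    moreover have "?h ` r k = r k" by (rule trans[OF image_cong[OF refl hf(2)] image_ident])
    ultimately show ?thesis by (simp only: s0_def if_distrib[of "image ?h"] if_cancel)
  qed
  have z_s0: "k > e" if "z \<in> s0 k" for k using that z(1) by (auto simp: s0_def split: if_splits)
  have z'_s0: "k \<le> e" "z \<in> r k" if "z' \<in> s0 k" for k
    using that z'_r[of k] by (auto simp: s0_def split: if_splits)
  have other: "y \<in> r k" if "y \<in> s0 k" "y \<noteq> z'" for k y
    using that by (auto simp: s0_def split: if_splits)
  have other': "y \<in> s0 k" if "y \<in> r k" "y \<noteq> z" for k y
    using that by (auto simp: s0_def image_iff)
  have fin: "finite (s0 k)" for k using strip_finite[OF r(1), of k] by (simp add: s0_def)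
  have card: "card (s0 k) = 3" for k
  proof -
    have "inj_on ?f (r k)" using z'_r[of k] by (auto simp: inj_on_def)
    from card_image[OF this] show ?thesis by (simp only: s0_def strip_card[OF r(1)] if_distrib[of card] if_cancel)
  qed
  have share: "2 \<le> card (s0 k \<inter> s0 l)"
    if "2 \<le> card (r k \<inter> r l)" "(k \<le> e \<longleftrightarrow> l \<le> e) \<or> z \<notin> r k \<inter> r l" for k l
  proof -
    have "\<exists>a b. a \<noteq> b \<and> {a, b} \<subseteq> r k \<inter> r l"
      using that(1) two_le_card_iff[of "r k \<inter> r l"] strip_finite[OF r(1)] by blast
    then obtain a b where ab: "a \<noteq> b" "a \<in> r k" "b \<in> r k" "a \<in> r l" "b \<in> r l" by blast
    show ?thesis
    proof (cases "k \<le> e \<longleftrightarrow> l \<le> e")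
      case True
      have neq: "?f a \<noteq> ?f b" using ab z'_r by metis
      have mem: "?f a \<in> ?f ` r k" "?f b \<in> ?f ` r k" "?f a \<in> ?f ` r l" "?f b \<in> ?f ` r l"
        using ab by blast+
      have "2 \<le> card (s0 k \<inter> s0 l)" if "k \<le> e"
      proof -
        have "l \<le> e" using that True by simp
        then have kl: "s0 k = ?f ` r k" "s0 l = ?f ` r l" using that by (simp_all only: s0_def if_True)
        show ?thesis by (rule card_inter_ge_2I[OF neq _ _ _ _ fin]) (simp_all only: kl mem)
      qed
      moreover have "2 \<le> card (s0 k \<inter> s0 l)" if "\<not> k \<le> e"
        using that True \<open>2 \<le> card (r k \<inter> r l)\<close> by (simp add: s0_def)
      ultimately show ?thesis by blast
    next
      case False
      then have "a \<noteq> z" "b \<noteq> z" using that(2) ab by auto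
      then show ?thesis using ab other' fin by (intro card_inter_ge_2I[of a b]) auto
    qed
  qed
  have far: "2 \<le> card (r k \<inter> r l)" if "2 \<le> card (s0 k \<inter> s0 l)" for k l
  proof -
    have "\<exists>a b. a \<noteq> b \<and> {a, b} \<subseteq> s0 k \<inter> s0 l"
      using that two_le_card_iff[of "s0 k \<inter> s0 l"] fin by blast
    then obtain a b where ab: "a \<noteq> b" "a \<in> s0 k" "b \<in> s0 k" "a \<in> s0 l" "b \<in> s0 l" by blast
    have "\<not> (z \<in> s0 k \<and> z' \<in> s0 k)" using z_s0[of k] z'_s0(1)[of k] by linarith
    then have "?h a \<noteq> ?h b" using ab by auto
    moreover have "?h a \<in> r k" "?h b \<in> r k" "?h a \<in> r l" "?h b \<in> r l"
      using ab h_s0[of k] h_s0[of l] by blast+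
    ultimately show ?thesis
      using strip_finite[OF r(1)] by (intro card_inter_ge_2I[of "?h a" "?h b"])
  qed
  define s where "s k = s0 (k mod m)" for k
  have s: "triangle_strip m s" "range s = s0 ` {..<m}"
  proof -
    have "2 \<le> card (s0 i \<inter> s0 (Suc i))" if "Suc i < m" for i
      using strip_step[OF r(1), of i] e(3) by (intro share) (cases "i = e"; auto)+
    moreover have "2 \<le> card (s0 (m - 1) \<inter> s0 0)"
      using strip_step[OF r(1), of "m - 1"] strip_periodic[OF r(1), of 0] m e(1) by (intro share) auto
    moreover have "j = Suc i \<or> i = 0 \<and> j = m - 1" if "i < j" "j < m" "2 \<le> card (s0 i \<inter> s0 j)" for i j
      using strip_far_card[OF r(1), of i j] far[OF that(3)] that by auto
    ultimately have "triangle_strip m (\<lambda>k. s0 (k mod m))" "range (\<lambda>k. s0 (k mod m)) = s0 ` {..<m}"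
      using triangle_stripI[of m s0] m card by auto
    then show "triangle_strip m s" "range s = s0 ` {..<m}" unfolding s_def by auto
  qed
  have lt: "k mod m < m" for k using m by simp
  show thesis
  proof (rule that[OF s(1)])
    have "(`) ?h ` range s = (\<lambda>k. ?h ` s0 k) ` {..<m}" unfolding s(2) by (simp only: image_image)
    also have "\<dots> = range t" unfolding h_s0 strip_range[OF r(1), symmetric] by (rule r(2))
    finally show "range t = (`) ?h ` range s" by (rule sym)
    show "\<Union> (range s) = insert z' (\<Union> (range t))"
    proof
      have "s0 k \<subseteq> insert z' (r k)" for k using other by blast
      then show "\<Union> (range s) \<subseteq> insert z' (\<Union> (range t))" unfolding s(2) r(2)[symmetric] by blast
      have "z' \<in> s0 e" using e(2) by (auto simp: s0_def)
      moreover have "z \<in> s0 (m - 1)" using e by (simp add: s0_def)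
      moreover have "r k \<subseteq> insert z (s0 k)" for k using other' by blast
      moreover have "{e, m - 1} \<subseteq> {..<m}" using e m by auto
      ultimately show "insert z' (\<Union> (range t)) \<subseteq> \<Union> (range s)"
        unfolding s(2) r(2)[symmetric] strip_range[OF r(1)] by blast
    qed
    show "\<not> (z \<in> s k \<and> z' \<in> s k)" for k
      using z_s0[of "k mod m"] z'_s0(1)[of "k mod m"] unfolding s_def by linarith
    fix k l c assume zc: "z \<in> s k" "c \<in> s k" "z' \<in> s l"
    show "c \<notin> s l"
    proof
      assume "c \<in> s l"
      let ?k = "k mod m" and ?l = "l mod m"
      have kl: "e < ?k" "?l \<le> e" "z \<in> r ?l" using z_s0 z'_s0 zc by (auto simp: s_def)
      then have c: "c \<noteq> z" "c \<noteq> z'"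
        using z_s0[of ?l] z'_s0(1)[of ?k] zc \<open>c \<in> s l\<close> unfolding s_def by force+
      then have "c \<in> r ?k" "c \<in> r ?l" "z \<in> r ?k" using other zc \<open>c \<in> s l\<close> z(1) by (auto simp: s_def)
      then have "?k = Suc ?l \<or> Suc ?k = ?l + m"
        using strip_far[OF r(1), of ?l ?k z c] kl c lt[of k] by auto
      then show False
      proof
        assume "?k = Suc ?l"
        then have "?k = Suc e" using kl by linarith
        then show False using \<open>z \<in> r ?k\<close> e(3) by simp
      next
        assume "Suc ?k = ?l + m"
        then have "?l = 0" using lt[of k] by linarith
        then show False using kl(3) e(1) by simp
      qed
    qed
  qed (use z in auto)
qed

text \<open>
  As \<open>uv\<close> lies in no triangle, \<open>uvx\<close> shares an edge with exactly the outer neighbours of \<open>uwx\<close> and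
  \<open>wvx\<close>, so the shorter sequence is a strip again. The vertex \<open>w\<close> occurs only in the two merged
  triangles, because its run is \<open>uwx\<close>, \<open>wvx\<close> and it has no other, so splitting \<open>uv\<close> restores \<open>t\<close>.
\<close>

lemma contract_fan:
  assumes strip: "triangle_strip m t" and runs: "single_runs m t" and m: "5 \<le> m"
    and fan: "fan (\<lambda>i. t (i + k)) u w v x" and chord: "\<And>j. \<not> {u, v} \<subseteq> t j"
    and no_common: "\<nexists>z. \<forall>i. z \<in> t i"
  obtains s where "triangle_strip (m - 1) s" "\<nexists>z. \<forall>i. z \<in> s i"
    and "{u, v, x} \<in> range s" "range t = range s - {{u, v, x}} \<union> {{u, w, x}, {w, v, x}}"
    and "w \<notin> \<Union> (range s)" "\<And>i. {u, v} \<subseteq> s i \<Longrightarrow> s i = {u, v, x}"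
proof -
  define r where "r i = t (i + Suc k)" for i
  have r: "triangle_strip m r" "range r = range t" "single_runs m r"
    unfolding r_def using strip_rotate[OF strip, of "Suc k"] strip_range_shift[OF strip, of "Suc k"]
      single_runs_shift[OF runs, of "Suc k"] by auto
  note far = strip_far[OF r(1)]
  have d: "u \<noteq> w" "u \<noteq> v" "u \<noteq> x" "w \<noteq> v" "w \<noteq> x" "v \<noteq> x"
    and t: "{u, x} \<subseteq> t k" "t (Suc k) = {u, w, x}" "t (Suc (Suc k)) = {w, v, x}" "{v, x} \<subseteq> t (Suc (Suc (Suc k)))"
    using fan by (auto simp: fan_def eval_nat_numeral)
  have r0: "r 0 = {u, w, x}" and r1: "r 1 = {w, v, x}" and r2: "{v, x} \<subseteq> r 2"
    using t by (simp_all add: r_def eval_nat_numeral)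
  have "m - 1 + Suc k = k + m" using m by simp
  then have rm: "{u, x} \<subseteq> r (m - 1)" using t(1) strip_periodic[OF strip, of k] by (simp only: r_def)
  have chord': "\<not> {u, v} \<subseteq> r i" for i using chord by (simp add: r_def)
  \<comment> \<open>in \<open>r\<close> the two triangles to be merged come first\<close>
  define s0 where "s0 i = (if i = 0 then {u, v, x} else r (Suc i))" for i
  define s where "s i = s0 (i mod (m - 1))" for i
  have fin: "finite (s0 i)" for i using strip_finite[OF r(1)] by (simp add: s0_def)
  have s: "triangle_strip (m - 1) s" "range s = s0 ` {..<m - 1}"
  proof -
    have "card (s0 i) = 3" for i using strip_card[OF r(1)] d by (simp add: s0_def)
    moreover have "2 \<le> card (s0 i \<inter> s0 (Suc i))" for i
    proof (cases "i = 0")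
      case True
      then show ?thesis
        using r2 d fin by (intro card_inter_ge_2I[of v x]) (auto simp: s0_def numeral_2_eq_2)
    next
      case False
      then show ?thesis using strip_step[OF r(1), of "Suc i"] by (simp add: s0_def)
    qed
    moreover have "2 \<le> card (s0 (m - 1 - 1) \<inter> s0 0)"
    proof -
      have "Suc (m - 1 - 1) = m - 1" "m - 1 - 1 \<noteq> 0" using m by auto
      then have "s0 (m - 1 - 1) = r (m - 1)" by (simp only: s0_def if_False)
      then show ?thesis using rm d strip_finite[OF r(1)]
        by (intro card_inter_ge_2I[of u x]) (auto simp: s0_def)
    qed
    moreover have "j = Suc i \<or> i = 0 \<and> j = m - 1 - 1"
      if ij: "i < j" "j < m - 1" "2 \<le> card (s0 i \<inter> s0 j)" for i j
    proof (cases "i = 0")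
      case False
      then have "2 \<le> card (r (Suc i) \<inter> r (Suc j))" using ij by (simp add: s0_def)
      moreover have "Suc i < Suc j" "Suc j < Suc i + m" using ij by auto
      ultimately have "Suc j = Suc (Suc i) \<or> Suc (Suc j) = Suc i + m"
        using strip_far_card[OF r(1)] by blast
      then show ?thesis using ij(2) by linarith
    next
      case True
      then have sj: "s0 i = {u, v, x}" "s0 j = r (Suc j)" using ij by (auto simp: s0_def)
      have "\<exists>a b. a \<noteq> b \<and> {a, b} \<subseteq> {u, v, x} \<inter> r (Suc j)"
        using ij(3) sj two_le_card_iff[of "{u, v, x} \<inter> r (Suc j)"] by auto
      then have "{u, x} \<subseteq> r (Suc j) \<or> {v, x} \<subseteq> r (Suc j)" using chord'[of "Suc j"] by auto
      then show ?thesis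
      proof
        assume "{u, x} \<subseteq> r (Suc j)"
        then have "Suc j = Suc 0 \<or> Suc (Suc j) = 0 + m"
          using far[of 0 "Suc j" u x] r0 d(3) ij(1,2) by simp
        then show ?thesis using ij(1,2) True by auto
      next
        assume "{v, x} \<subseteq> r (Suc j)"
        then have "Suc j = Suc 1 \<or> Suc (Suc j) = 1 + m"
          using far[of 1 "Suc j" v x] r1 d(6) ij(1,2) True by simp
        then show ?thesis using ij(2) True by auto
      qed
    qed
    ultimately have "triangle_strip (m - 1) (\<lambda>i. s0 (i mod (m - 1)))"
      "range (\<lambda>i. s0 (i mod (m - 1))) = s0 ` {..<m - 1}"
      using triangle_stripI[of "m - 1" s0] m by auto
    then show "triangle_strip (m - 1) s" "range s = s0 ` {..<m - 1}" unfolding s_def by auto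
  qed
  have "{..<m - 1} = insert 0 {1..<m - 1}" using m by auto
  then have range_s: "range s = insert {u, v, x} (r ` {2..<m})"
  proof -
    have "s0 ` {1..<m - 1} = r ` Suc ` {1..<m - 1}"
      unfolding image_image by (intro image_cong) (auto simp: s0_def)
    also have "Suc ` {1..<m - 1} = {2..<m}" using m by (simp add: image_Suc_atLeastLessThan numeral_2_eq_2)
    finally have "s0 ` {1..<m - 1} = r ` {2..<m}" .
    moreover have "s0 0 = {u, v, x}" by (simp add: s0_def)
    ultimately show ?thesis unfolding s(2) \<open>{..<m - 1} = _\<close> by (simp only: image_insert)
  qed
  have "{..<m} = {0, 1} \<union> {2..<m}" using m by auto
  then have range_t: "range t = {{u, w, x}, {w, v, x}} \<union> r ` {2..<m}"
    using r0 r1 unfolding r(2)[symmetric] strip_range[OF r(1)] by auto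
  have new: "{u, v, x} \<notin> r ` {2..<m}" using chord' by blast
  have w_r: "w \<notin> r i" if "i \<in> {2..<m}" for i
  proof
    assume "w \<in> r i"
    have w2: "w \<notin> r 2"
      by (rule notI) (use far[of 0 2 w x] r0 r2 d(5) m in simp)
    have "1 < m - 1" "m - 1 < 1 + m" "m - 1 \<noteq> Suc 1" "Suc (m - 1) \<noteq> 1 + m" "w \<in> r 1" "x \<in> r 1"
      using m r1 by auto
    then have wm: "w \<notin> r (m - 1)" using far[of 1 "m - 1" w x] rm d(5) by blast
    then have "i \<noteq> m - 1" using \<open>w \<in> r i\<close> by metis
    then have "i < m - 1" using that by auto
    from this \<open>w \<in> r i\<close> wm obtain e where e: "i \<le> e" "e < m - 1" "w \<in> r e" "w \<notin> r (Suc e)"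
      by (rule leaves_between[OF r(1)])
    have "1 < e" "e < 1 + m" using e that by auto
    moreover have "w \<in> r 1" "w \<notin> r (Suc 1)" using r1 w2 by (simp_all add: numeral_2_eq_2)
    moreover note e(3,4)
    ultimately show False using r(3) unfolding single_runs_def by blast
  qed
  show thesis
  proof (rule that[OF s(1)])
    show "\<nexists>z. \<forall>i. z \<in> s i"
    proof
      assume "\<exists>z. \<forall>i. z \<in> s i"
      then obtain z where "\<forall>y \<in> range s. z \<in> y" by auto
      then have z: "z \<in> {u, v, x}" "\<And>i. i \<in> {2..<m} \<Longrightarrow> z \<in> r i" unfolding range_s by auto
      have "{2, m - 1} \<subseteq> {2..<m}" using m by auto
      then have "z \<noteq> u" "z \<noteq> v" using z(2)[of 2] z(2)[of "m - 1"] chord'[of 2] chord'[of "m - 1"] r2 rm by auto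
      then have "\<forall>y\<in>range t. z \<in> y" unfolding range_t using z by auto
      then show False using no_common by blast
    qed
    show "{u, v, x} \<in> range s" unfolding range_s by simp
    show "range t = range s - {{u, v, x}} \<union> {{u, w, x}, {w, v, x}}"
      unfolding range_s range_t using new by auto
    show "w \<notin> \<Union> (range s)" unfolding range_s using w_r d by auto
    show "s i = {u, v, x}" if "{u, v} \<subseteq> s i" for i
    proof -
      have "s i \<in> insert {u, v, x} (r ` {2..<m})" using range_s by auto
      then show ?thesis using that chord' by auto
    qed
  qed
qed

subsection \<open>The irreducible strips are the starting graphs\<close>

text \<open>
  In the starting graphs any induced cycle of the right length may be specified, so it is enough to
  recognize the graph.
\<close>

lemma derivableI:
  assumes strip: "triangle_strip m t" and f: "inj_on f (\<Union> (range t))"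
    and T: "(`) f ` range t = T" and H: "triangle_union T = H"
    and wd: "\<And>S. induced_cycle (triangle_graph H) S \<Longrightarrow> card S = m \<Longrightarrow> weakly_derived H S"
  shows "derivable (range t)"
proof -
  note s = strip_image[OF strip f]
  have "range (\<lambda>i. f ` t i) = T" using T by (simp add: image_image)
  then have "induced_cycle (triangle_graph H) T" "card T = m"
    using strip_induced_cycle[OF s] strip_card_range[OF s] H by auto
  then have "weakly_derived (triangle_union T) T" using wd H by simp
  then show ?thesis using f T unfolding derivable_def by blast
qed

lemma triangle_union_square_cycle:
  assumes "5 \<le> n"
  shows "triangle_union ((\<lambda>i. {i, Suc i mod n, Suc (Suc i mod n) mod n}) ` {..<n}) =
    graph_square (cycle_graph n)" (is "triangle_union ?Q = ?H")
proof -
  have "0 < n" using assms by simp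
  then have "\<Union> ?Q = {..<n}" by auto
  then have verts: "pverts (triangle_union ?Q) = pverts ?H"
    by (simp add: triangle_union_simps pverts_square_cycle)
  have "(a, b) \<in> parcs (triangle_union ?Q) \<longleftrightarrow> (a, b) \<in> parcs ?H" for a b
  proof
    assume "(a, b) \<in> parcs (triangle_union ?Q)"
    then obtain i where "i < n" "a \<noteq> b" "a \<in> {i, Suc i mod n, Suc (Suc i mod n) mod n}"
      "b \<in> {i, Suc i mod n, Suc (Suc i mod n) mod n}"
      unfolding triangle_union_simps by blast
    then show "(a, b) \<in> parcs ?H"
      using assms by (auto simp: parcs_square_cycle)
  next
    assume "(a, b) \<in> parcs ?H"
    then have ab: "a < n" "b < n" "a \<noteq> b"
      "b = Suc a mod n \<or> a = Suc b mod n \<or> b = Suc (Suc a mod n) mod n \<or> a = Suc (Suc b mod n) mod n"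
      using assms by (auto simp: parcs_square_cycle)
    then have "\<exists>i<n. {a, b} \<subseteq> {i, Suc i mod n, Suc (Suc i mod n) mod n}" by blast
    then show "(a, b) \<in> parcs (triangle_union ?Q)"
      unfolding triangle_union_simps using ab(3) by blast
  qed
  then have "parcs (triangle_union ?Q) = parcs ?H" by auto
  with verts show ?thesis by simp
qed

lemma less_6_cases: "a < 6 \<longleftrightarrow> a = 0 \<or> a = 1 \<or> a = 2 \<or> a = 3 \<or> a = 4 \<or> a = (5 :: nat)"
  by auto

lemma triangle_union_K6_minus_K3:
  "triangle_union {{3, 5, 2}, {3, 0, 5}, {0, 4, 5}, {4, 5, 1}, {3, 4, 1}, {3, 4, 2}} = K6_minus_K3"
proof -
  let ?Q = "{{3, 5, 2}, {3, 0, 5}, {0, 4, 5}, {4, 5, 1}, {3, 4, 1}, {3, 4, 2 :: nat}}"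
  have "\<Union> ?Q = {..<6}" by auto
  moreover have "(a, b) \<in> parcs (triangle_union ?Q) \<longleftrightarrow> (a, b) \<in> parcs K6_minus_K3" for a b
  proof -
    have "(a, b) \<in> parcs K6_minus_K3 \<longleftrightarrow> a < 6 \<and> b < 6 \<and> a \<noteq> b \<and> \<not> (a < 3 \<and> b < 3)"
      by (auto simp: K6_minus_K3_def delete_edges_def complete_graph_def)
    also have "\<dots> \<longleftrightarrow> (a, b) \<in> parcs (triangle_union ?Q)"
      unfolding triangle_union_simps less_6_cases by auto
    finally show ?thesis ..
  qed
  then have "parcs (triangle_union ?Q) = parcs K6_minus_K3" by auto
  ultimately show ?thesis
    by (simp add: triangle_union_def K6_minus_K3_def delete_edges_def complete_graph_def)
qed

lemma triangle_union_K6_minus_P4: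
  "triangle_union {{5, 4, 2}, {5, 1, 4}, {1, 3, 4}, {3, 4, 0}, {5, 3, 0}, {5, 0, 2}} = K6_minus_P4"
proof -
  let ?Q = "{{5, 4, 2}, {5, 1, 4}, {1, 3, 4}, {3, 4, 0}, {5, 3, 0}, {5, 0, 2 :: nat}}"
  have "\<Union> ?Q = {..<6}" by auto
  moreover have "(a, b) \<in> parcs (triangle_union ?Q) \<longleftrightarrow> (a, b) \<in> parcs K6_minus_P4" for a b
  proof -
    have "(a, b) \<in> parcs K6_minus_P4 \<longleftrightarrow>
        a < 6 \<and> b < 6 \<and> a \<noteq> b \<and> \<not> (a < 4 \<and> b < 4 \<and> (b = Suc a \<or> a = Suc b))"
      by (auto simp: K6_minus_P4_def delete_edges_def complete_graph_def path_graph_def)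
    also have "\<dots> \<longleftrightarrow> (a, b) \<in> parcs (triangle_union ?Q)"
      unfolding triangle_union_simps less_6_cases by auto
    finally show ?thesis ..
  qed
  then have "parcs (triangle_union ?Q) = parcs K6_minus_P4" by auto
  ultimately show ?thesis
    by (simp add: triangle_union_def K6_minus_P4_def delete_edges_def complete_graph_def)
qed

lemma irreducible_strip_derivable:
  assumes strip: "triangle_strip m t" and m: "5 \<le> m"
    and runs: "single_runs m t" and uns: "unsplittable t"
  shows "derivable (range t)"
proof (cases "\<exists>z i. z \<in> t i \<and> z \<in> t (i + 1) \<and> z \<in> t (i + 2) \<and> z \<in> t (i + 3)")
  case False
  then have "\<not> (z \<in> t i \<and> z \<in> t (i + 1) \<and> z \<in> t (i + 2) \<and> z \<in> t (i + 3))" for z i by blast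
  then obtain X where X: "inj_on X {..<m}"
    and range: "range t = (\<lambda>i. {X i, X (Suc i mod m), X (Suc (Suc i mod m) mod m)}) ` {..<m}"
    by (rule strip_without_fan[OF strip runs])
  let ?f = "the_inv_into {..<m} X" and ?s = "\<lambda>i. Suc i mod m"
  have f: "?f (X i) = i" if "i < m" for i using that X by (simp add: the_inv_into_f_f)
  have lt: "?s i < m" for i using m by simp
  show ?thesis
  proof (rule derivableI[OF strip _ _ triangle_union_square_cycle[OF m]])
    have "\<Union> (range t) \<subseteq> X ` {..<m}" unfolding range using lt by auto
    then show "inj_on ?f (\<Union> (range t))" using inj_on_the_inv_into[OF X] by (rule inj_on_subset[rotated])
    show "(`) ?f ` range t = (\<lambda>i. {i, ?s i, ?s (?s i)}) ` {..<m}"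
      unfolding range image_image using f lt by (intro image_cong) auto
    show "weakly_derived (graph_square (cycle_graph m)) S"
      if "induced_cycle (triangle_graph (graph_square (cycle_graph m))) S" "card S = m" for S
      using weakly_derived.square[OF m refl that] .
  qed
next
  case True
  then obtain z i where zi: "z \<in> t i" "z \<in> t (i + 1)" "z \<in> t (i + 2)" "z \<in> t (i + 3)" by blast
  define r where "r k = t (k + i)" for k
  have r: "triangle_strip m r" "single_runs m r" "unsplittable r" "range r = range t"
    unfolding r_def using strip_rotate[OF strip] single_runs_shift[OF runs]
      unsplittable_shift[OF strip uns] strip_range_shift[OF strip] by auto
  have "z \<in> r 0" "z \<in> r 1" "z \<in> r 2" "z \<in> r 3" using zi by (simp_all add: r_def add.commute)
  then obtain u' w' v' where fan: "fan r u' w' v' z" by (rule fan_exists[OF r(1)])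
  obtain u v w x z q where d: "distinct [u, v, w, x, z, q]" and "m = 6"
    and range: "range t = {{u, x, q}, {u, w, x}, {w, v, x}, {v, x, z}, {u, v, z}, {u, v, q}} \<or>
      range t = {{u, x, q}, {u, w, x}, {w, v, x}, {v, x, z}, {u, v, z}, {u, z, q}}"
    using irreducible_strip_with_fan[OF r(1-3) fan] r(4) by auto
  from range show ?thesis
  proof
    assume range: "range t = {{u, x, q}, {u, w, x}, {w, v, x}, {v, x, z}, {u, v, z}, {u, v, q}}"
    let ?f = "(\<lambda>_. 0)(z := 1, q := 2, u := 3, v := 4, x := 5 :: nat)"
    have f: "?f w = 0" "?f z = 1" "?f q = 2" "?f u = 3" "?f v = 4" "?f x = 5"
      using d by auto
    show ?thesis
    proof (rule derivableI[OF strip _ _ triangle_union_K6_minus_K3])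
      have "inj_on ?f {u, v, w, x, z, q}" using d by auto
      then show "inj_on ?f (\<Union> (range t))" by (rule inj_on_subset) (auto simp: range)
      show "(`) ?f ` range t = {{3, 5, 2}, {3, 0, 5}, {0, 4, 5}, {4, 5, 1}, {3, 4, 1}, {3, 4, 2}}"
        unfolding range by (simp only: f image_insert image_empty)
      show "weakly_derived K6_minus_K3 S"
        if "induced_cycle (triangle_graph K6_minus_K3) S" "card S = m" for S
        using weakly_derived.K6_K3[OF refl that(1)] that(2) \<open>m = 6\<close> by simp
    qed
  next
    assume range: "range t = {{u, x, q}, {u, w, x}, {w, v, x}, {v, x, z}, {u, v, z}, {u, z, q}}"
    let ?f = "(\<lambda>_. 0)(w := 1, q := 2, v := 3, x := 4, u := 5 :: nat)"
    have f: "?f z = 0" "?f w = 1" "?f q = 2" "?f v = 3" "?f x = 4" "?f u = 5"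
      using d by auto
    show ?thesis
    proof (rule derivableI[OF strip _ _ triangle_union_K6_minus_P4])
      have "inj_on ?f {u, v, w, x, z, q}" using d by auto
      then show "inj_on ?f (\<Union> (range t))" by (rule inj_on_subset) (auto simp: range)
      show "(`) ?f ` range t = {{5, 4, 2}, {5, 1, 4}, {1, 3, 4}, {3, 4, 0}, {5, 3, 0}, {5, 0, 2}}"
        unfolding range by (simp only: f image_insert image_empty)
      show "weakly_derived K6_minus_P4 S"
        if "induced_cycle (triangle_graph K6_minus_P4) S" "card S = m" for S
        using weakly_derived.K6_P4[OF refl that(1)] that(2) \<open>m = 6\<close> by simp
    qed
  qed
qed

lemma strip_card_Union_le:
  assumes strip: "triangle_strip m t"
  shows "card (\<Union> (range t)) \<le> 3 * m"
proof -
  have "card (\<Union> (range t)) \<le> (\<Sum>y\<in>range t. card y)"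
    using card_Union_le_sum_card by blast
  also have "\<dots> = (\<Sum>y\<in>range t. 3)" by (rule sum.cong) (use strip_card[OF strip] in auto)
  finally show ?thesis using strip_card_range[OF strip] by simp
qed

text \<open>
  Separating the runs of a vertex adds a vertex, and contracting a fan removes a triangle and at
  most one vertex, so \<open>3m\<close> minus the number of vertices decreases in either case.
\<close>

lemma strip_derivable:
  fixes t :: "nat \<Rightarrow> 'a set"
  assumes "infinite (UNIV :: 'a set)" "triangle_strip m t" "\<nexists>z. \<forall>i. z \<in> t i"
  shows "derivable (range t)"
  using assms(2,3)
proof (induction "3 * m - card (\<Union> (range t))" arbitrary: m t rule: less_induct)
  case less
  note strip = less.prems(1)
  note le = strip_card_Union_le[OF strip] and fin = strip_finite_Union[OF strip]
  have "m \<noteq> 4" using strip_common_if_4[OF strip] less.prems(2) by blast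
  then have m: "5 \<le> m" using strip_ge_4[OF strip] by simp
  consider "\<not> single_runs m t" | "single_runs m t" "\<not> unsplittable t" | "single_runs m t" "unsplittable t"
    by blast
  then show ?case
  proof cases
    case 1
    obtain z' where z': "z' \<notin> \<Union> (range t)" using ex_new_if_finite[OF assms(1) fin] by blast
    let ?h = "\<lambda>z y. if y = z' then z else y"
    from separate_runs[OF strip 1 z'] obtain s z where s: "triangle_strip m s"
      and range: "range t = (`) (?h z) ` range s" and z: "z \<noteq> z'" "z \<in> \<Union> (range t)"
      and Un: "\<Union> (range s) = insert z' (\<Union> (range t))"
      and sep: "\<And>k. \<not> (z \<in> s k \<and> z' \<in> s k)"
      and far: "\<And>k l c. z \<in> s k \<Longrightarrow> c \<in> s k \<Longrightarrow> z' \<in> s l \<Longrightarrow> c \<notin> s l" by blast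
    have "card (\<Union> (range s)) = Suc (card (\<Union> (range t)))" unfolding Un using z' fin by simp
    then have "3 * m - card (\<Union> (range s)) < 3 * m - card (\<Union> (range t))"
      using strip_card_Union_le[OF s] by linarith
    moreover have "\<nexists>y. \<forall>i. y \<in> s i"
    proof
      assume "\<exists>y. \<forall>i. y \<in> s i"
      then obtain y where "\<forall>T\<in>range s. y \<in> T" by blast
      then have "\<forall>T\<in>range t. ?h z y \<in> T" unfolding range by blast
      then show False using less.prems(2) by blast
    qed
    ultimately have "derivable (range s)" using less.hyps s by blast
    then have "derivable ((`) (?h z) ` range s)"
    proof (intro derivable_stick[OF s refl z(1)])
      show "z \<in> \<Union> (range s)" "z' \<in> \<Union> (range s)" unfolding Un using z by auto
    qed (use sep far in blast)+
    then show ?thesis using range by simp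
  next
    case 2
    then obtain k u w v x where fan: "fan (\<lambda>i. t (i + k)) u w v x" and chord: "\<And>j. \<not> {u, v} \<subseteq> t j"
      unfolding unsplittable_def by blast
    obtain s where s: "triangle_strip (m - 1) s" "\<nexists>z. \<forall>i. z \<in> s i"
      and uvx: "{u, v, x} \<in> range s" and range: "range t = range s - {{u, v, x}} \<union> {{u, w, x}, {w, v, x}}"
      and w: "w \<notin> \<Union> (range s)" and priv: "\<And>i. {u, v} \<subseteq> s i \<Longrightarrow> s i = {u, v, x}"
      using contract_fan[OF strip 2(1) m fan chord less.prems(2)] by blast
    have "\<Union> (range t) \<subseteq> insert w (\<Union> (range s))" unfolding range using uvx by blast
    then have "card (\<Union> (range t)) \<le> Suc (card (\<Union> (range s)))"
      using card_mono[of "insert w (\<Union> (range s))" "\<Union> (range t)"] strip_finite_Union[OF s(1)] w by simp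
    then have "3 * (m - 1) - card (\<Union> (range s)) < 3 * m - card (\<Union> (range t))"
      using strip_card_Union_le[OF s(1)] le m by linarith
    then have "derivable (range s)" using less.hyps s by blast
    moreover have "distinct [u, v, x, w]" using fan by (auto simp: fan_def)
    ultimately show ?thesis
      unfolding range using derivable_split[OF s(1) refl uvx _ w] priv by blast
  next
    case 3
    then show ?thesis by (rule irreducible_strip_derivable[OF strip m])
  qed
qed

lemma derivable_image:
  assumes g: "inj_on g (\<Union> S)" and der: "derivable ((`) g ` S)"
  shows "derivable S"
proof -
  have Un: "\<Union> ((`) g ` S) = g ` \<Union> S" by auto
  from der obtain f :: "'b \<Rightarrow> nat" where f: "inj_on f (g ` \<Union> S)"
    "weakly_derived (triangle_union ((`) f ` (`) g ` S)) ((`) f ` (`) g ` S)"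
    unfolding derivable_def Un by blast
  have "(`) f ` (`) g ` S = (`) (f \<circ> g) ` S" by (simp add: image_image image_comp)
  moreover have "inj_on (f \<circ> g) (\<Union> S)" using comp_inj_on[OF g f(1)] .
  ultimately show ?thesis unfolding derivable_def using f(2) by metis
qed

section \<open>From a cycle of triangles to a forbidden subgraph\<close>

text \<open>
  Every shared edge contains the common vertex \<open>x\<close>; the other ends of the shared edges form the rim
  of a wheel with hub \<open>x\<close>.
\<close>

lemma strip_with_common_vertex:
  assumes G: "parcs G \<subseteq> pverts G \<times> pverts G" "sym (parcs G)"
    and strip: "triangle_strip m t" "range t \<subseteq> triangles G" and x: "\<And>i. x \<in> t i"
  shows "contains_copy G (wheel_graph m)"
proof -
  note m = strip_ge_4[OF strip(1)] and far = strip_far[OF strip(1)]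
  have "\<forall>i. \<exists>y. y \<noteq> x \<and> y \<in> t i \<and> y \<in> t (Suc i)"
  proof
    fix i
    obtain y where "y \<noteq> x" "t i \<inter> t (Suc i) = {x, y}" by (rule strip_edge[OF strip(1) x x])
    then show "\<exists>y. y \<noteq> x \<and> y \<in> t i \<and> y \<in> t (Suc i)" by blast
  qed
  then obtain y where y: "\<And>i. y i \<noteq> x" "\<And>i. y i \<in> t i" "\<And>i. y i \<in> t (Suc i)" by metis
  have "y i \<noteq> y j" if "i < j" "j < m" for i j
  proof
    assume eq: "y i = y j"
    have "j = Suc i \<or> Suc j = i + m" using far[of i j "y i" x] that x y(1,2) eq by (metis trans_less_add2)
    then show False
    proof
      assume "j = Suc i"
      then show False
        using far[of i "Suc j" "y i" x] x y(1)[of i] y(2)[of i] y(3)[of j] eq m that by auto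
    next
      assume "Suc j = i + m"
      then have "i = 0" "j = m - 1" using that by auto
      then have mem: "y i \<in> t 1" "y i \<in> t (m - 1)" using y(3)[of i] y(2)[of j] eq by simp_all
      have "1 < m - 1" "m - 1 < 1 + m" "m - 1 \<noteq> Suc 1" "Suc (m - 1) \<noteq> 1 + m" using m by auto
      then show False using far[of 1 "m - 1" "y i" x] x y(1)[of i] mem by blast
    qed
  qed
  then have inj: "inj_on y {..<m}"
    by (intro linorder_inj_onI) auto
  have tri: "(a, b) \<in> parcs G" if "a \<in> t i" "b \<in> t i" "a \<noteq> b" for a b i
    using strip(2) that by (auto simp: triangles_def)
  show ?thesis
  proof (rule contains_wheelI[OF G _ inj])
    fix i assume i: "i < m"
    show "(x, y i) \<in> parcs G" using tri[of x i "y i"] x y by metis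
    have "i \<noteq> Suc i mod m" "Suc i mod m < m" using i m by (auto simp: Suc_mod_eq)
    then have "y i \<noteq> y (Suc i mod m)" using inj i by (auto dest: inj_onD)
    moreover have "y (Suc i mod m) \<in> t (Suc i)"
      using y(2)[of "Suc i mod m"] strip_mod[OF strip(1), of "Suc i"] by simp
    ultimately show "(y i, y (Suc i mod m)) \<in> parcs G" using tri y(3) by blast
  qed (use m y(1) in auto)
qed

lemma derivable_contains_copy:
  assumes G: "parcs G \<subseteq> pverts G \<times> pverts G" and S: "S \<subseteq> triangles G" and der: "derivable S"
  shows "\<exists>H S. weakly_derived H S \<and> contains_copy G H"
proof -
  from der obtain f :: "'a \<Rightarrow> nat" where f: "inj_on f (\<Union> S)"
    and wd: "weakly_derived (triangle_union ((`) f ` S)) ((`) f ` S)"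
    by (auto simp: derivable_def)
  let ?h = "the_inv_into (\<Union> S) f" and ?H = "triangle_union ((`) f ` S)"
  have V: "pverts ?H = f ` \<Union> S" by (auto simp: triangle_union_simps)
  have h: "?h (f y) = y" if "y \<in> \<Union> S" for y using f that by (rule the_inv_into_f_f)
  have "contains_copy G ?H"
  proof (rule contains_copyI[of _ _ ?h, OF G triangle_union_wf])
    show "inj_on ?h (pverts ?H)" unfolding V using f by (rule inj_on_the_inv_into)
    have "\<Union> S \<subseteq> pverts G" using S by (auto simp: triangles_def)
    moreover have "?h ` f ` \<Union> S = \<Union> S"
      unfolding image_image by (rule trans[OF image_cong[OF refl h] image_ident])
    ultimately show "?h ` pverts ?H \<subseteq> pverts G" unfolding V by simp
    fix a b assume "(a, b) \<in> parcs ?H"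
    then obtain s a' b' where s: "s \<in> S" "a' \<in> s" "b' \<in> s" "a = f a'" "b = f b'" "a \<noteq> b"
      unfolding triangle_union_simps by blast
    then have "a' \<in> \<Union> S" "b' \<in> \<Union> S" by blast+
    then have "?h a = a'" "?h b = b'" using h s(4,5) by auto
    moreover have "s \<in> triangles G" using s(1) S by blast
    then have "(a', b') \<in> parcs G" using s by (auto simp: triangles_def)
    ultimately show "(?h a, ?h b) \<in> parcs G" by simp
  qed
  then show ?thesis using wd by blast
qed

text \<open>
  The strip is moved to the natural numbers first: separating runs takes vertices outside the strip,
  which a finite vertex type need not provide.
\<close>

lemma strip_without_common_vertex:
  fixes t :: "nat \<Rightarrow> 'a set"
  assumes G: "parcs G \<subseteq> pverts G \<times> pverts G"
    and strip: "triangle_strip m t" "range t \<subseteq> triangles G" and no_common: "\<nexists>x. \<forall>i. x \<in> t i"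
  shows "\<exists>H S. weakly_derived H S \<and> contains_copy G H"
proof -
  obtain g :: "'a \<Rightarrow> nat" where g: "inj_on g (\<Union> (range t))"
    using finite_imp_inj_to_nat_seg[OF strip_finite_Union[OF strip(1)]] by blast
  have "\<nexists>z. \<forall>i. z \<in> g ` t i"
  proof
    assume "\<exists>z. \<forall>i. z \<in> g ` t i"
    then obtain z where z: "\<And>i. z \<in> g ` t i" by blast
    from z[of 0] obtain y where y: "z = g y" "y \<in> t 0" by (rule imageE)
    have "y \<in> t i" for i
    proof -
      from z[of i] obtain y' where y': "z = g y'" "y' \<in> t i" by (rule imageE)
      have "y = y'" using y y' by (intro inj_onD[OF g]) auto
      then show ?thesis using y' by simp
    qed
    then show False using no_common by blast
  qed
  then have "derivable (range (\<lambda>i. g ` t i))"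
    by (rule strip_derivable[OF infinite_UNIV_nat strip_image[OF strip(1) g]])
  then have "derivable ((`) g ` range t)" by (simp only: image_image)
  then have "derivable (range t)" by (rule derivable_image[OF g])
  then show ?thesis by (rule derivable_contains_copy[OF G strip(2)])
qed

lemma contains_K5_minus_K3I:
  assumes G: "parcs G \<subseteq> pverts G \<times> pverts G" "sym (parcs G)" and d: "distinct [x, y, a, b, c]"
    and e: "(x, y) \<in> parcs G" "\<And>z. z \<in> {a, b, c} \<Longrightarrow> (x, z) \<in> parcs G \<and> (y, z) \<in> parcs G"
  shows "contains_copy G K5_minus_K3"
proof (rule contains_copyI[of _ _ "\<lambda>i. [a, b, c, x, y] ! i", OF G(1)])
  have V: "pverts K5_minus_K3 = {..<5}"
    by (simp add: K5_minus_K3_def delete_edges_def complete_graph_def)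
  have A: "(i, j) \<in> parcs K5_minus_K3 \<longleftrightarrow> i < 5 \<and> j < 5 \<and> i \<noteq> j \<and> \<not> (i < 3 \<and> j < 3)" for i j
    by (auto simp: K5_minus_K3_def delete_edges_def complete_graph_def)
  have less: "i < 5 \<longleftrightarrow> i = 0 \<or> i = 1 \<or> i = 2 \<or> i = 3 \<or> i = (4 :: nat)" for i by auto
  have arcs: "(p, q) \<in> parcs G" if "p \<in> {x, y}" "q \<in> {x, y, a, b, c}" "p \<noteq> q" for p q
    using that e symD[OF G(2) e(1)] by auto
  show "parcs K5_minus_K3 \<subseteq> pverts K5_minus_K3 \<times> pverts K5_minus_K3" using A V by auto
  show "inj_on (\<lambda>i. [a, b, c, x, y] ! i) (pverts K5_minus_K3)"
    unfolding V using d by (intro inj_on_nth) auto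
  have "{a, b, c, x, y} \<subseteq> pverts G" using G(1) e by blast
  then show "(\<lambda>i. [a, b, c, x, y] ! i) ` pverts K5_minus_K3 \<subseteq> pverts G"
    unfolding V by (auto simp: less)
  fix i j assume "(i, j) \<in> parcs K5_minus_K3"
  then have ij: "i < 5" "j < 5" "i \<noteq> j" "3 \<le> i \<or> 3 \<le> j" using A by auto
  have in_xy: "[a, b, c, x, y] ! k \<in> {x, y}" if "3 \<le> k" "k < 5" for k using that by (auto simp: less)
  have in_all: "[a, b, c, x, y] ! k \<in> {x, y, a, b, c}" if "k < 5" for k using that by (auto simp: less)
  have "[a, b, c, x, y] ! i \<noteq> [a, b, c, x, y] ! j"
    using d ij by (subst nth_eq_iff_index_eq) auto
  then show "([a, b, c, x, y] ! i, [a, b, c, x, y] ! j) \<in> parcs G"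
    using ij(4) arcs[OF in_xy in_all] symD[OF G(2) arcs[OF in_xy in_all]] ij by metis
qed

text \<open>
  Let \<open>s = xya\<close> and \<open>t = xyb\<close>. If \<open>r\<close> contains \<open>xy\<close>, the three triangles share an edge. Otherwise \<open>r\<close>
  meets both in two vertices only if it contains \<open>ab\<close>, which completes a \<open>K\<^sub>4\<close>.
\<close>

lemma three_mutually_adjacent_triangles:
  assumes G: "parcs G \<subseteq> pverts G \<times> pverts G" "sym (parcs G)"
    and tri: "r \<in> triangles G" "s \<in> triangles G" "t \<in> triangles G" "r \<noteq> s" "r \<noteq> t" "s \<noteq> t"
    and adj: "2 \<le> card (s \<inter> t)" "2 \<le> card (r \<inter> s)" "2 \<le> card (r \<inter> t)"
  shows "contains_copy G (wheel_graph 3) \<or> contains_copy G K5_minus_K3"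
proof -
  have fin: "finite r" "finite s" "finite t" using tri finite_triangle by auto
  have pair: "\<exists>a b. a \<noteq> b \<and> {a, b} \<subseteq> A \<inter> B" if "2 \<le> card (A \<inter> B)" "finite A" for A B :: "'a set"
    using that two_le_card_iff[of "A \<inter> B"] by auto
  have third: "\<exists>c. A = {x, y, c} \<and> c \<noteq> x \<and> c \<noteq> y"
    if "A \<in> triangles G" "{x, y} \<subseteq> A" "x \<noteq> y" for A x y
  proof -
    have "card (A - {x, y}) = 1"
      using that finite_triangle[OF that(1)] by (simp add: card_Diff_subset triangles_def)
    then obtain c where "A - {x, y} = {c}" by (auto simp: card_1_singleton_iff)
    then show ?thesis using that by (intro exI[of _ c]) blast
  qed
  have arc: "(p, q) \<in> parcs G" if "A \<in> triangles G" "p \<in> A" "q \<in> A" "p \<noteq> q" for A p q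
    using that by (auto simp: triangles_def)
  obtain x y where xy: "x \<noteq> y" "{x, y} \<subseteq> s \<inter> t" using pair[OF adj(1)] fin by blast
  obtain a where a: "s = {x, y, a}" "a \<noteq> x" "a \<noteq> y" using third[OF tri(2)] xy by blast
  obtain b where b: "t = {x, y, b}" "b \<noteq> x" "b \<noteq> y" using third[OF tri(3)] xy by blast
  have "a \<noteq> b" using a b tri(6) by auto
  show ?thesis
  proof (cases "{x, y} \<subseteq> r")
    case True
    then obtain c where c: "r = {x, y, c}" "c \<noteq> x" "c \<noteq> y" using third[OF tri(1)] xy by blast
    have "c \<noteq> a" "c \<noteq> b" using a b c tri(4,5) by auto
    then have "contains_copy G K5_minus_K3"
      using a b c xy(1) \<open>a \<noteq> b\<close> arc[OF tri(1)] arc[OF tri(2)] arc[OF tri(3)]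
      by (intro contains_K5_minus_K3I[OF G, of x y a b c]) auto
    then show ?thesis ..
  next
    case False
    obtain p q where pq: "p \<noteq> q" "{p, q} \<subseteq> r \<inter> s" using pair[OF adj(2)] fin by blast
    obtain p' q' where pq': "p' \<noteq> q'" "{p', q'} \<subseteq> r \<inter> t" using pair[OF adj(3)] fin by blast
    have "a \<in> r" "b \<in> r" using False pq pq' a b by auto
    then have "contains_copy G (wheel_graph 3)"
      using a b xy(1) \<open>a \<noteq> b\<close> arc[OF tri(1), of a b] arc[OF tri(2)] arc[OF tri(3)]
      by (intro contains_K4I[OF G, of x y a b]) auto
    then show ?thesis ..
  qed
qed

text \<open>A chord of a polygon cuts off a shorter polygon.\<close>

lemma shortest_polygon_chordless:
  assumes c: "polygon R n c" and min: "\<And>n' c'. polygon R n' c' \<Longrightarrow> n \<le> n'"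
    and sym: "\<And>a b. R a b \<Longrightarrow> R b a" and ij: "i < j" "j < n" "R (c i) (c j)"
  shows "j = Suc i \<or> i = 0 \<and> j = n - 1"
proof (rule ccontr)
  assume no: "\<not> ?thesis"
  let ?n = "Suc (j - i)" and ?c = "\<lambda>k. c (i + k)"
  have "polygon R ?n ?c"
  proof (rule polygonI)
    show "3 \<le> ?n" using no ij by auto
    show "inj_on ?c {..<?n}"
    proof (rule inj_onI)
      fix k l assume "k \<in> {..<?n}" "l \<in> {..<?n}" "?c k = ?c l"
      then have "i + k = i + l"
        using inj_onD[OF polygonD(2)[OF c], of "i + k" "i + l"] ij by simp
      then show "k = l" by simp
    qed
    show "R (?c k) (?c (Suc k))" if "Suc k < ?n" for k
      using polygonD(3)[OF c, of "i + k"] that ij by simp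
    show "R (?c (?n - 1)) (?c 0)" using sym ij by simp
  qed
  then have "n \<le> ?n" by (rule min)
  then show False using no ij by auto
qed

lemma triangle_cyclic_contains_forbidden:
  assumes G: "parcs G \<subseteq> pverts G \<times> pverts G" "sym (parcs G)" and cyc: "triangle_cyclic G"
  shows "(\<exists>n\<ge>3. contains_copy G (wheel_graph n)) \<or> contains_copy G K5_minus_K3 \<or>
    (\<exists>H S. weakly_derived H S \<and> contains_copy G H)"
proof -
  have ex: "\<exists>n. \<exists>c. triangle_polygon G n c" using cyc by (simp add: triangle_cyclic_def)
  define n where "n = (LEAST n. \<exists>c. triangle_polygon G n c)"
  obtain c where c: "triangle_polygon G n c" using LeastI_ex[OF ex] by (auto simp: n_def)
  have min: "n \<le> n'" if "triangle_polygon G n' c'" for n' c'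
    unfolding n_def using that by (blast intro: Least_le)
  have n: "3 \<le> n" using polygonD(1)[OF c] .
  have tri: "c i \<in> triangles G" if "i < n" for i
    using c that by (auto simp: polygon_def parcs_triangle_graph)
  have neq: "c i \<noteq> c j" if "i < n" "j < n" "i \<noteq> j" for i j
    using polygonD(2)[OF c] that by (auto dest: inj_onD)
  have step: "2 \<le> card (c i \<inter> c (Suc i))" if "Suc i < n" for i
    using polygonD(3)[OF c that] by (simp add: parcs_triangle_graph)
  have last: "2 \<le> card (c (n - 1) \<inter> c 0)"
    using polygonD(4)[OF c] by (simp add: parcs_triangle_graph)
  show ?thesis
  proof (cases "n = 3")
    case True
    have "contains_copy G (wheel_graph 3) \<or> contains_copy G K5_minus_K3"
      using tri[of 0] tri[of 1] tri[of 2] neq[of 0 1] neq[of 0 2] neq[of 1 2] step[of 0] step[of 1] last True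
      by (intro three_mutually_adjacent_triangles[OF G, of "c 0" "c 1" "c 2"])
        (auto simp: numeral_2_eq_2 Int_commute)
    then show ?thesis by blast
  next
    case False
    then have n4: "4 \<le> n" using n by simp
    let ?t = "\<lambda>i. c (i mod n)"
    have t: "triangle_strip n ?t" "range ?t = c ` {..<n}"
    proof -
      have "card (c i) = 3" if "i < n" for i using tri[OF that] by (simp add: triangles_def)
      moreover have "j = Suc i \<or> i = 0 \<and> j = n - 1"
        if "i < j" "j < n" "2 \<le> card (c i \<inter> c j)" for i j
      proof (rule shortest_polygon_chordless[OF c min])
        show "(b, a) \<in> parcs (triangle_graph G)" if "(a, b) \<in> parcs (triangle_graph G)" for a b
          using that triangle_graph_sym by (rule symD[rotated])
        show "(c i, c j) \<in> parcs (triangle_graph G)"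
          using that tri[of i] tri[of j] neq[of i j] by (simp add: parcs_triangle_graph)
      qed (use that in auto)
      ultimately show "triangle_strip n ?t" "range ?t = c ` {..<n}"
        using triangle_stripI[of n c] n4 step last by blast+
    qed
    have sub: "range ?t \<subseteq> triangles G" unfolding t(2) using tri by auto
    show ?thesis
    proof (cases "\<exists>x. \<forall>i. x \<in> ?t i")
      case True
      then obtain x where "\<And>i. x \<in> ?t i" by blast
      from strip_with_common_vertex[OF G t(1) sub this] n show ?thesis by blast
    next
      case False
      from strip_without_common_vertex[OF G(1) t(1) sub False] show ?thesis by blast
    qed
  qed
qed

theorem corollary15:
  fixes G :: "'a pair_pre_digraph"
  assumes "pair_graph G"
  shows "undirected_tree (triangle_graph G) \<longleftrightarrow>
    triangle_connected G \<and>
    \<not> ((\<exists>n \<ge> 3. contains_copy G (wheel_graph n)) \<or>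
       contains_copy G K5_minus_K3 \<or>
       (\<exists>n \<ge> 5. contains_copy G (graph_square (cycle_graph n))) \<or>
       contains_copy G K6_minus_K3 \<or>
       contains_copy G K6_minus_P4 \<or>
       (\<exists>H S. weakly_derived H S \<and> contains_copy G H))"
proof -
  interpret pair_graph G by (rule assms)
  have "parcs G \<subseteq> pverts G \<times> pverts G" using in_arcsD1 in_arcsD2 by auto
  moreover have "sym (parcs G)" using pair_sym_arcs by (simp add: symmetric_def)
  ultimately have fwd: "triangle_cyclic G \<Longrightarrow> (\<exists>n\<ge>3. contains_copy G (wheel_graph n)) \<or>
      contains_copy G K5_minus_K3 \<or> (\<exists>H S. weakly_derived H S \<and> contains_copy G H)"
    by (rule triangle_cyclic_contains_forbidden)
  have K4: "triangle_cyclic (wheel_graph 3)" by (rule triangle_cyclic_wheel) simp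
  have bwd: "triangle_cyclic G" if "contains_copy G (H :: nat pair_pre_digraph)" "triangle_cyclic H" for H
    using that by (rule triangle_cyclic_copy)
  show ?thesis
    unfolding undirected_tree_triangle_graph_iff
    using fwd bwd triangle_cyclic_wheel triangle_cyclic_K5_minus_K3 triangle_cyclic_square_cycle
      triangle_cyclic_copy[OF K4_in_K6_minus_K3 K4] triangle_cyclic_copy[OF K4_in_K6_minus_P4 K4]
      triangle_cyclic_weakly_derived
    by blast
qed

end
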